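(* Let $d\ge1$, $\varepsilon>0$, let $V:\mathbb{R}^d\to\mathbb{R}$ and $c:\mathbb{R}^d\to[0,\infty)$ be $1$-periodic in each coordinate, with each component of $DV$ of class $C^{1,\alpha}$ and $c$ of class $C^\alpha$ for some $\alpha\in(0,1]$, and put $c^*(x)=\mathrm{tr}[D^2V(x)]$, with $c-c^*\ge0$. Let $(\psi^\varepsilon,\lambda^\varepsilon)$ and $(\phi^\varepsilon,\lambda^\varepsilon)$ be the dominant eigenfunction/eigenvalue pairs of the periodic eigenvalue problems $$-\mathcal{L}^{\varepsilon,*}\psi^\varepsilon+c\,\psi^\varepsilon=\lambda^\varepsilon\psi^\varepsilon,\qquad -\mathcal{L}^{\varepsilon}\phi^\varepsilon+c\,\phi^\varepsilon=\lambda^\varepsilon\phi^\varepsilon,$$ and write $\psi^\varepsilon=e^{-\frac1\varepsilon\Psi}$, $\phi^\varepsilon=e^{-\frac1\varepsilon\Phi}$. For smooth (periodic) $h:[0,1]^d\times[0,1]^d\to\mathbb{R}$ define $\mathcal{H}^\varepsilon$ by $$2\mathcal{H}^\varepsilon h(x,y)=-\langle D_xV(x),D_xh(x,y)\rangle+\langle D_yV(y),D_yh(x,y)\rangle-\frac{\varepsilon}{2}\mathrm{tr}[D_x^2h(x,y)]-\frac{\varepsilon}{2}\mathrm{tr}[D_y^2h(x,y)]-c^*(x)h(x,y)+c(x)h(x,y)+c(y)h(x,y).$$ Then $(h^\varepsilon,\lambda^\varepsilon)$, with $h^\varepsilon(x,y)=\psi^\varepsilon(x)\phi^\varepsilon(y)$,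 is an eigenfunction/eigenvalue pair for $\mathcal{H}^\varepsilon$, i.e. $\mathcal{H}^\varepsilon h^\varepsilon=\lambda^\varepsilon h^\varepsilon$. Furthermore, if $$\mathcal{A}^\varepsilon f(x,y)=e^{-\frac1\varepsilon\left(\Psi(y)+\Phi(x)-\Psi(x)-\Phi(y)\right)^+}\left[f(y,x)-f(x,y)\right],$$ and $\mathcal{A}^{\varepsilon,*}$ denotes the adjoint of $\mathcal{A}^\varepsilon$, then $(h^\varepsilon,\lambda^\varepsilon)$ is also the dominant eigenfunction/eigenvalue pair for $\mathcal{H}^\varepsilon-\mathcal{A}^{\varepsilon,*}$.
   Context: All functions are $1$-periodic in each coordinate, so $[0,1]^d$ is treated as the torus $\mathbb{R}^d/\mathbb{Z}^d$. $Df$, $D^2f$ are gradient and Hessian; subscripts $x,y$ indicate the variable of differentiation; $a^+=\max\{a,0\}$. The operators are $$\mathcal{L}^{\varepsilon}f=-\langle DV,Df\rangle+\frac{\varepsilon}{2}\mathrm{tr}[D^2f],\qquad \mathcal{L}^{\varepsilon,*}f=\langle DV,Df\rangle+\frac{\varepsilon}{2}\mathrm{tr}[D^2f]+c^*f,$$ where $\mathcal{L}^{\varepsilon,*}$ is the formal adjoint of $\mathcal{L}^\varepsilon$. The adjoint $\mathcal{A}^{\varepsilon,*}$ is taken with respect to Lebesgue measure $dx\,dy$ on $[0,1)^d\times[0,1)^d$. For an operator $\mathcal{M}$ with the sign convention of minus a generator plus a killing rate (such as $-\mathcal{L}^{\varepsilon,*}+c$, $-\mathcal{L}^{\varepsilon}+c$,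 $\mathcal{H}^\varepsilon$, $\mathcal{H}^\varepsilon-\mathcal{A}^{\varepsilon,*}$), acting on periodic functions, the dominant eigenfunction/eigenvalue pair is a pair $(g,\lambda)$ with $\mathcal{M}g=\lambda g$ such that $\lambda$ is a real simple eigenvalue, $\mathrm{Re}(\gamma)>\lambda$ for every other eigenvalue $\gamma$ of $\mathcal{M}$, and $g$ is strictly positive (and unique up to a positive multiplicative constant). It is known that under the stated assumptions $-\mathcal{L}^{\varepsilon,*}+c$ and $-\mathcal{L}^{\varepsilon}+c$ have dominant pairs with the same eigenvalue $\lambda^\varepsilon$, with strictly positive eigenfunctions $\psi^\varepsilon,\phi^\varepsilon$ of class $C^{2,\alpha}$ for some $\alpha\in(0,1]$; hence $\Psi=-\varepsilon\log\psi^\varepsilon$ and $\Phi=-\varepsilon\log\phi^\varepsilon$ are well defined. *)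

theory Defs
  imports "HOL-Analysis.Analysis"
begin

section \<open>Function spaces on the torus\<close>

text \<open>Functions on a torus are periodic functions on the whole of a Euclidean space. The
  definitions are generic in the space, so that they apply both to \<open>real^'n\<close> and
  to \<open>(real^'n) \<times> (real^'n)\<close>, and generic in the scalars (real or complex).\<close>

definition periodic :: "('a::euclidean_space \<Rightarrow> 'b) \<Rightarrow> bool" where
  "periodic f \<longleftrightarrow> (\<forall>b\<in>Basis. \<forall>x. f (x + b) = f x)"

definition pd :: "'a::euclidean_space \<Rightarrow> ('a \<Rightarrow> 'b::real_normed_vector) \<Rightarrow> 'a \<Rightarrow> 'b" where
  "pd b f x = frechet_derivative f (at x) b"

definition class_C1 :: "('a::euclidean_space \<Rightarrow> 'b::real_normed_vector) \<Rightarrow> bool" where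
  "class_C1 f \<longleftrightarrow> (\<forall>x. f differentiable (at x)) \<and> (\<forall>b\<in>Basis. continuous_on UNIV (pd b f))"

definition class_C2 :: "('a::euclidean_space \<Rightarrow> 'b::real_normed_vector) \<Rightarrow> bool" where
  "class_C2 f \<longleftrightarrow> class_C1 f \<and> (\<forall>b\<in>Basis. class_C1 (pd b f))"

text \<open>For periodic functions the global Hoelder condition is the usual one on the torus.\<close>

definition hoelder :: "real \<Rightarrow> ('a::euclidean_space \<Rightarrow> 'b::real_normed_vector) \<Rightarrow> bool" where
  "hoelder \<alpha> f \<longleftrightarrow> (\<exists>K. \<forall>x y. dist (f x) (f y) \<le> K * dist x y powr \<alpha>)"

definition class_C1_hoelder :: "real \<Rightarrow> ('a::euclidean_space \<Rightarrow> 'b::real_normed_vector) \<Rightarrow> bool" where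
  "class_C1_hoelder \<alpha> f \<longleftrightarrow> class_C1 f \<and> (\<forall>b\<in>Basis. hoelder \<alpha> (pd b f))"

definition periodic_C0 :: "('a::euclidean_space \<Rightarrow> 'b::real_normed_vector) set" where
  "periodic_C0 = {f. periodic f \<and> continuous_on UNIV f}"

definition periodic_C2 :: "('a::euclidean_space \<Rightarrow> 'b::real_normed_vector) set" where
  "periodic_C2 = {f. periodic f \<and> class_C2 f}"


section \<open>Eigenpairs and dominant eigenpairs\<close>

definition eigenpair ::
  "(('a::euclidean_space \<Rightarrow> 'b::real_normed_field) \<Rightarrow> 'a \<Rightarrow> 'b) \<Rightarrow> ('a \<Rightarrow> 'b) \<Rightarrow> 'b \<Rightarrow> bool" where
  "eigenpair M f \<gamma> \<longleftrightarrow> f \<in> periodic_C2 \<and> f \<noteq> (\<lambda>_. 0) \<and> (\<forall>x. M f x = \<gamma> * f x)"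

text \<open>Elements of the kernel of some power of \<open>M - \<gamma>\<close>, where the domain of \<open>M\<close> is
  \<open>periodic_C2\<close>, so that the intermediate iterates have to lie in it.\<close>

definition generalized_eigenfunction ::
  "(('a::euclidean_space \<Rightarrow> complex) \<Rightarrow> 'a \<Rightarrow> complex) \<Rightarrow> complex \<Rightarrow> ('a \<Rightarrow> complex) \<Rightarrow> bool" where
  "generalized_eigenfunction M \<gamma> f \<longleftrightarrow>
    (let T = (\<lambda>u x. M u x - \<gamma> * u x) in
      \<exists>k. (\<forall>j<k. (T ^^ j) f \<in> periodic_C2) \<and> (T ^^ k) f = (\<lambda>_. 0))"

text \<open>Simplicity is algebraic: the generalized eigenspace is one-dimensional.\<close>

definition simple_eigenvalue ::
  "(('a::euclidean_space \<Rightarrow> complex) \<Rightarrow> 'a \<Rightarrow> complex) \<Rightarrow> complex \<Rightarrow> bool" where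
  "simple_eigenvalue M \<gamma> \<longleftrightarrow>
    (\<exists>g. eigenpair M g \<gamma> \<and>
      (\<forall>f. generalized_eigenfunction M \<gamma> f \<longrightarrow> (\<exists>k. f = (\<lambda>x. k * g x))))"

text \<open>The eigenfunction \<open>g\<close> is real, while the competing eigenvalues and their
  eigenfunctions are complex; so \<open>M\<close> is the operator on complex-valued functions.\<close>

definition dominant_pair ::
  "(('a::euclidean_space \<Rightarrow> complex) \<Rightarrow> 'a \<Rightarrow> complex) \<Rightarrow> ('a \<Rightarrow> real) \<Rightarrow> real \<Rightarrow> bool" where
  "dominant_pair M g \<mu> \<longleftrightarrow>
    eigenpair M (\<lambda>x. complex_of_real (g x)) (complex_of_real \<mu>) \<and>
    simple_eigenvalue M (complex_of_real \<mu>) \<and>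
    (\<forall>\<gamma> f. eigenpair M f \<gamma> \<and> \<gamma> \<noteq> complex_of_real \<mu> \<longrightarrow> Re \<gamma> > \<mu>) \<and>
    (\<forall>x. g x > 0) \<and>
    (\<forall>g'. eigenpair M (\<lambda>x. complex_of_real (g' x)) (complex_of_real \<mu>) \<and> (\<forall>x. g' x > 0)
      \<longrightarrow> (\<exists>k>0. g' = (\<lambda>x. k * g x)))"


section \<open>Adjoint with respect to Lebesgue measure on the unit cell\<close>

definition unit_cell :: "'a::euclidean_space set" where
  "unit_cell = {x. \<forall>b\<in>Basis. 0 \<le> x \<bullet> b \<and> x \<bullet> b < 1}"

definition L2_inner :: "('a::euclidean_space \<Rightarrow> complex) \<Rightarrow> ('a \<Rightarrow> complex) \<Rightarrow> complex" where
  "L2_inner f g = (LINT x:unit_cell|lborel. f x * cnj (g x))"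

text \<open>For operators that are bounded on continuous periodic functions. By density and
  continuity there is at most one continuous periodic \<open>k\<close> with the adjoint property; for such
  operators as \<open>A_op\<close> below this is the restriction of the \<open>L2\<close> adjoint.\<close>

definition torus_adjoint ::
  "(('a::euclidean_space \<Rightarrow> complex) \<Rightarrow> 'a \<Rightarrow> complex) \<Rightarrow> ('a \<Rightarrow> complex) \<Rightarrow> 'a \<Rightarrow> complex" where
  "torus_adjoint A g =
    (THE k. k \<in> periodic_C0 \<and> (\<forall>f\<in>periodic_C0. L2_inner (A f) g = L2_inner f k))"


section \<open>The operators\<close>

definition grad :: "(real^'n \<Rightarrow> 'b::real_normed_field) \<Rightarrow> real^'n \<Rightarrow> 'b^'n" where
  "grad f x = (\<chi> i. pd (axis i 1) f x)"

definition hess :: "(real^'n \<Rightarrow> 'b::real_normed_field) \<Rightarrow> real^'n \<Rightarrow> 'b^'n^'n" where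
  "hess f x = (\<chi> i j. pd (axis j 1) (pd (axis i 1) f) x)"

text \<open>The inner product of a real vector with a vector of real or complex scalars,
  extended linearly in the second argument.\<close>

definition pairing :: "real^'n \<Rightarrow> 'b::real_normed_field^'n \<Rightarrow> 'b" where
  "pairing v w = (\<Sum>i\<in>UNIV. v $ i *\<^sub>R w $ i)"

definition cstar :: "(real^'n \<Rightarrow> real) \<Rightarrow> real^'n \<Rightarrow> real" where
  "cstar V x = trace (hess V x)"

definition L_op :: "real \<Rightarrow> (real^'n \<Rightarrow> real) \<Rightarrow>
    (real^'n \<Rightarrow> 'b::real_normed_field) \<Rightarrow> real^'n \<Rightarrow> 'b" where
  "L_op \<epsilon> V f x = - pairing (grad V x) (grad f x) + (\<epsilon> / 2) *\<^sub>R trace (hess f x)"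

definition Lstar_op :: "real \<Rightarrow> (real^'n \<Rightarrow> real) \<Rightarrow>
    (real^'n \<Rightarrow> 'b::real_normed_field) \<Rightarrow> real^'n \<Rightarrow> 'b" where
  "Lstar_op \<epsilon> V f x =
    pairing (grad V x) (grad f x) + (\<epsilon> / 2) *\<^sub>R trace (hess f x) + cstar V x *\<^sub>R f x"

definition H_op :: "real \<Rightarrow> (real^'n \<Rightarrow> real) \<Rightarrow> (real^'n \<Rightarrow> real) \<Rightarrow>
    ((real^'n) \<times> (real^'n) \<Rightarrow> 'b::real_normed_field) \<Rightarrow> (real^'n) \<times> (real^'n) \<Rightarrow> 'b" where
  "H_op \<epsilon> V c h = (\<lambda>(x, y). (1 / 2) *\<^sub>R
    (- pairing (grad V x) (grad (\<lambda>x'. h (x', y)) x)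
     + pairing (grad V y) (grad (\<lambda>y'. h (x, y')) y)
     - (\<epsilon> / 2) *\<^sub>R trace (hess (\<lambda>x'. h (x', y)) x)
     - (\<epsilon> / 2) *\<^sub>R trace (hess (\<lambda>y'. h (x, y')) y)
     - cstar V x *\<^sub>R h (x, y) + c x *\<^sub>R h (x, y) + c y *\<^sub>R h (x, y)))"

definition A_op :: "real \<Rightarrow> (real^'n \<Rightarrow> real) \<Rightarrow> (real^'n \<Rightarrow> real) \<Rightarrow>
    ((real^'n) \<times> (real^'n) \<Rightarrow> 'b::real_normed_field) \<Rightarrow> (real^'n) \<times> (real^'n) \<Rightarrow> 'b" where
  "A_op \<epsilon> \<Psi> \<Phi> f = (\<lambda>(x, y).
    exp (- (1 / \<epsilon>) * max (\<Psi> y + \<Phi> x - \<Psi> x - \<Phi> y) 0) *\<^sub>R (f (y, x) - f (x, y)))"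

end

theory Submission
  imports Defs
begin

text \<open>The weight of \<open>A_op\<close> is the Metropolis acceptance probability \<open>min 1 (h (y, x) / h (x, y))\<close>,
  so it satisfies detailed balance with respect to \<open>h\<close>, and the adjoint of \<open>A_op\<close> annihilates \<open>h\<close>.
  Dividing eigenfunctions by \<open>h\<close> (ground state transform) turns the operator into \<open>lam - G\<close>, where
  \<open>G\<close> generates a jump diffusion on the torus. By Hopf's strong maximum principle a real \<open>v\<close> with
  \<open>G v \<ge> 0\<close> is constant; hence \<open>G v\<close> is constant only for constant \<open>v\<close>, which is algebraic
  simplicity. If \<open>G u = - z u\<close> and \<open>Re z \<le> 0\<close>, then \<open>G\<close> of the squared modulus of \<open>u\<close> is
  \<open>- 2 Re z\<close> times the squared modulus plus a nonnegative carre du champ term. So the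
  squared modulus is constant, the gradient of \<open>u\<close> vanishes, \<open>u\<close> is constant and \<open>z = 0\<close>.\<close>

section \<open>Calculus with partial derivatives\<close>

lemma pd_eqI: "(f has_derivative D) (at x) \<Longrightarrow> pd b f x = D b"
  by (simp add: pd_def frechet_derivative_at[symmetric])

lemma has_derivative_frechet:
  "f differentiable (at x) \<Longrightarrow> (f has_derivative (\<lambda>v. pd v f x)) (at x)"
  unfolding pd_def by (metis frechet_derivative_works)

lemma class_C1_differentiable: "class_C1 f \<Longrightarrow> f differentiable (at x)"
  by (simp add: class_C1_def)

lemma class_C1_has_derivative:
  "class_C1 f \<Longrightarrow> (f has_derivative (\<lambda>v. pd v f x)) (at x)"
  by (simp add: class_C1_differentiable has_derivative_frechet)

lemma class_C1_continuous: "class_C1 f \<Longrightarrow> continuous_on UNIV f"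
  by (meson class_C1_differentiable continuous_at_imp_continuous_on differentiable_imp_continuous_within)

lemma class_C1_continuous_pd: "class_C1 f \<Longrightarrow> b \<in> Basis \<Longrightarrow> continuous_on UNIV (pd b f)"
  by (simp add: class_C1_def)

lemma class_C2_C1: "class_C2 f \<Longrightarrow> class_C1 f"
  by (simp add: class_C2_def)

lemma class_C2_pd: "class_C2 f \<Longrightarrow> b \<in> Basis \<Longrightarrow> class_C1 (pd b f)"
  by (simp add: class_C2_def)

lemma class_C1I:
  assumes "\<And>x. (f has_derivative D x) (at x)"
    and "\<And>b. b \<in> Basis \<Longrightarrow> continuous_on UNIV (\<lambda>x. D x b)"
  shows "class_C1 f"
proof -
  have "pd b f = (\<lambda>x. D x b)" for b
    using assms(1) pd_eqI by blast
  then show ?thesis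
    using assms unfolding class_C1_def differentiable_def by auto
qed

lemma pd_const [simp]: "pd b (\<lambda>_. k) = (\<lambda>_. 0)"
  by (rule ext, rule pd_eqI[where D="\<lambda>_. 0"]) simp

lemma class_C1_const [simp]: "class_C1 (\<lambda>_. k)"
  by (rule class_C1I[where D="\<lambda>_ _. 0"]) auto

lemma class_C2_const [simp]: "class_C2 (\<lambda>_. k)"
  by (simp add: class_C2_def)

section \<open>Sums, linear images and bilinear products of smooth functions\<close>

lemma pd_add:
  "class_C1 f \<Longrightarrow> class_C1 g \<Longrightarrow> pd b (\<lambda>x. f x + g x) = (\<lambda>x. pd b f x + pd b g x)"
  by (rule ext, rule pd_eqI) (intro has_derivative_add class_C1_has_derivative)

lemma class_C1_add: "class_C1 f \<Longrightarrow> class_C1 g \<Longrightarrow> class_C1 (\<lambda>x. f x + g x)"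
  by (rule class_C1I[where D="\<lambda>x v. pd v f x + pd v g x"])
     (auto intro!: has_derivative_add class_C1_has_derivative continuous_on_add class_C1_continuous_pd)

lemma class_C2_add: "class_C2 f \<Longrightarrow> class_C2 g \<Longrightarrow> class_C2 (\<lambda>x. f x + g x)"
  by (simp add: class_C2_def class_C1_add pd_add)

lemma class_C1_sum: "(\<And>i. i \<in> I \<Longrightarrow> class_C1 (f i)) \<Longrightarrow> class_C1 (\<lambda>x. \<Sum>i\<in>I. f i x)"
  by (induction I rule: infinite_finite_induct) (auto intro!: class_C1_add)

lemma pd_bounded_linear:
  assumes "bounded_linear L" "class_C1 f"
  shows "pd b (\<lambda>x. L (f x)) = (\<lambda>x. L (pd b f x))"
  by (rule ext, rule pd_eqI)
     (rule bounded_linear.has_derivative[OF assms(1)], rule class_C1_has_derivative[OF assms(2)])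

lemma class_C1_bounded_linear:
  assumes "bounded_linear L" "class_C1 f"
  shows "class_C1 (\<lambda>x. L (f x))"
  by (rule class_C1I[where D="\<lambda>x v. L (pd v f x)"])
     (rule bounded_linear.has_derivative[OF assms(1)] class_C1_has_derivative[OF assms(2)]
        bounded_linear.continuous_on[OF assms(1)] class_C1_continuous_pd[OF assms(2)] | assumption)+

lemma class_C2_bounded_linear:
  "bounded_linear L \<Longrightarrow> class_C2 f \<Longrightarrow> class_C2 (\<lambda>x. L (f x))"
  by (simp add: class_C2_def class_C1_bounded_linear pd_bounded_linear)

text \<open>The bilinear map is left abstract so that one product rule serves real products,
  \<open>scaleR\<close> of a real weight with a complex function, and the real inner product on
  \<open>complex\<close>.\<close>

lemma pd_bilinear:
  assumes "bounded_bilinear P" "class_C1 f" "class_C1 g"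
  shows "pd b (\<lambda>x. P (f x) (g x)) = (\<lambda>x. P (f x) (pd b g x) + P (pd b f x) (g x))"
  by (rule ext, rule pd_eqI)
     (rule bounded_bilinear.FDERIV[OF assms(1)]; rule class_C1_has_derivative, fact)

lemma class_C1_bilinear:
  assumes "bounded_bilinear P" "class_C1 f" "class_C1 g"
  shows "class_C1 (\<lambda>x. P (f x) (g x))"
proof (rule class_C1I[where D="\<lambda>x v. P (f x) (pd v g x) + P (pd v f x) (g x)"])
  show "((\<lambda>x. P (f x) (g x)) has_derivative
      (\<lambda>v. P (f x) (pd v g x) + P (pd v f x) (g x))) (at x)" for x
    by (rule bounded_bilinear.FDERIV[OF assms(1)]; rule class_C1_has_derivative, fact)
  show "continuous_on UNIV (\<lambda>x. P (f x) (pd b g x) + P (pd b f x) (g x))" if "b \<in> Basis" for b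
    using that assms
    by (intro continuous_on_add bounded_bilinear.continuous_on[OF assms(1)]
        class_C1_continuous class_C1_continuous_pd)
qed

lemma class_C2_bilinear:
  assumes "bounded_bilinear P" "class_C2 f" "class_C2 g"
  shows "class_C2 (\<lambda>x. P (f x) (g x))"
  using assms unfolding class_C2_def
  by (auto simp: pd_bilinear intro!: class_C1_add class_C1_bilinear[OF assms(1)])

lemma pd_pd_bilinear:
  assumes "bounded_bilinear P" "class_C2 f" "class_C2 g" "b \<in> Basis"
  shows "pd b (pd b (\<lambda>x. P (f x) (g x))) =
    (\<lambda>x. P (f x) (pd b (pd b g) x) + 2 *\<^sub>R P (pd b f x) (pd b g x) + P (pd b (pd b f) x) (g x))"
proof -
  note C1 = class_C2_C1[OF assms(2)] class_C2_C1[OF assms(3)]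
    class_C2_pd[OF assms(2,4)] class_C2_pd[OF assms(3,4)]
  show ?thesis
    using C1 assms(1)
    by (simp add: pd_bilinear pd_add class_C1_bilinear scaleR_2 algebra_simps fun_eq_iff)
qed

section \<open>Linear substitutions, reciprocals and vanishing derivatives\<close>

lemma pd_compose_linear:
  assumes "bounded_linear L" "class_C1 f"
  shows "pd b (\<lambda>x. f (L x)) = (\<lambda>x. pd (L b) f (L x))"
proof (rule ext, rule pd_eqI)
  fix x
  show "((\<lambda>x. f (L x)) has_derivative (\<lambda>b. pd (L b) f (L x))) (at x)"
    using has_derivative_compose[OF bounded_linear_imp_has_derivative[OF assms(1)]
        class_C1_has_derivative[OF assms(2)]] .
qed

text \<open>\<open>class_C1\<close> speaks of basis directions only, while a linear substitution may
  send a basis vector elsewhere (\<open>fst\<close> sends some to \<open>0\<close>). Linearity of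
  the derivative carries the information over to every direction.\<close>

lemma pd_eq_sum_Basis:
  assumes "class_C1 f"
  shows "pd v f = (\<lambda>x. \<Sum>b\<in>Basis. (v \<bullet> b) *\<^sub>R pd b f x)"
proof
  fix x
  have lin: "linear (\<lambda>v. pd v f x)"
    using class_C1_has_derivative[OF assms] has_derivative_linear by blast
  have "pd v f x = pd (\<Sum>b\<in>Basis. (v \<bullet> b) *\<^sub>R b) f x"
    by (simp add: euclidean_representation)
  also have "\<dots> = (\<Sum>b\<in>Basis. (v \<bullet> b) *\<^sub>R pd b f x)"
    by (simp only: linear_sum[OF lin] linear_cmul[OF lin])
  finally show "pd v f x = (\<Sum>b\<in>Basis. (v \<bullet> b) *\<^sub>R pd b f x)" .
qed

lemma class_C1_compose_linear:
  assumes "bounded_linear L" "class_C1 f"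
  shows "class_C1 (\<lambda>x. f (L x))"
proof (rule class_C1I)
  show "((\<lambda>x. f (L x)) has_derivative (\<lambda>b. pd (L b) f (L x))) (at x)" for x
    using has_derivative_compose[OF bounded_linear_imp_has_derivative[OF assms(1)]
        class_C1_has_derivative[OF assms(2)]] .
  have "continuous_on UNIV (pd v f)" for v
    unfolding pd_eq_sum_Basis[OF assms(2), of v]
    using assms by (intro continuous_intros class_C1_continuous_pd) auto
  then show "continuous_on UNIV (\<lambda>x. pd (L b) f (L x))" for b
    by (rule continuous_on_compose2[OF _ linear_continuous_on[OF assms(1)]]) auto
qed

lemma class_C2_compose_linear:
  assumes "bounded_linear L" "class_C2 f"
  shows "class_C2 (\<lambda>x. f (L x))"
proof -
  have C1: "class_C1 (pd v f)" for v
    unfolding pd_eq_sum_Basis[OF class_C2_C1[OF assms(2)], of v]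
    using assms
    by (intro class_C1_sum class_C1_bounded_linear[OF bounded_linear_scaleR_right] class_C2_pd)
  show ?thesis
    unfolding class_C2_def pd_compose_linear[OF assms(1) class_C2_C1[OF assms(2)]]
    using class_C1_compose_linear[OF assms(1) class_C2_C1[OF assms(2)]]
      class_C1_compose_linear[OF assms(1) C1] by blast
qed

lemma class_C1_inverse:
  fixes f :: "'a::euclidean_space \<Rightarrow> real"
  assumes "class_C1 f" "\<And>x. f x \<noteq> 0"
  shows "class_C1 (\<lambda>x. inverse (f x))"
    and "pd b (\<lambda>x. inverse (f x)) = (\<lambda>x. - (inverse (f x) * pd b f x * inverse (f x)))"
proof -
  have D: "((\<lambda>x. inverse (f x)) has_derivative (\<lambda>v. - (inverse (f x) * pd v f x * inverse (f x)))) (at x)" for x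
    using Deriv.has_derivative_inverse[OF assms(2) class_C1_has_derivative[OF assms(1)]] .
  show "class_C1 (\<lambda>x. inverse (f x))"
    by (rule class_C1I, rule D)
       (intro continuous_on_minus continuous_on_mult continuous_on_inverse
         class_C1_continuous[OF assms(1)] class_C1_continuous_pd[OF assms(1)] ballI assms(2))
  show "pd b (\<lambda>x. inverse (f x)) = (\<lambda>x. - (inverse (f x) * pd b f x * inverse (f x)))"
    by (rule ext, rule pd_eqI, rule D)
qed

lemma class_C2_inverse:
  fixes f :: "'a::euclidean_space \<Rightarrow> real"
  assumes "class_C2 f" "\<And>x. f x \<noteq> 0"
  shows "class_C2 (\<lambda>x. inverse (f x))"
  unfolding class_C2_def
proof (intro conjI ballI)
  note inv = class_C1_inverse[OF class_C2_C1[OF assms(1)] assms(2)]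
  show "class_C1 (\<lambda>x. inverse (f x))"
    by (rule inv)
  show "class_C1 (pd b (\<lambda>x. inverse (f x)))" if "b \<in> Basis" for b
    unfolding inv(2)
    by (intro class_C1_bounded_linear[OF bounded_linear_minus[OF bounded_linear_ident]]
        class_C1_bilinear[OF bounded_bilinear_mult] inv(1) class_C2_pd assms that)
qed

lemma constant_if_pd_eq_0:
  assumes "class_C1 f" "\<And>b x. b \<in> Basis \<Longrightarrow> pd b f x = 0"
  obtains k where "f = (\<lambda>_. k)"
proof -
  have "pd v f = (\<lambda>_. 0)" for v
    using assms(2) by (simp add: pd_eq_sum_Basis[OF assms(1), of v])
  then have "(f has_derivative (\<lambda>_. 0)) (at x)" for x
    using class_C1_has_derivative[OF assms(1), of x] by simp
  then obtain k where "\<And>x. f x = k"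
    using has_derivative_zero_constant[of UNIV f] by auto
  then show thesis
    by (intro that[of k] ext)
qed

section \<open>Periodic functions\<close>

lemma periodic_add_int:
  assumes "periodic f" "b \<in> Basis"
  shows "f (x + of_int n *\<^sub>R b) = f x"
proof (induction n rule: int_induct[where k=0])
  case (step1 i)
  have "f (x + of_int (i + 1) *\<^sub>R b) = f ((x + of_int i *\<^sub>R b) + b)"
    by (simp add: algebra_simps)
  also have "\<dots> = f (x + of_int i *\<^sub>R b)"
    using assms unfolding periodic_def by blast
  finally show ?case
    using step1 by simp
next
  case (step2 i)
  have "f (x + of_int i *\<^sub>R b) = f ((x + of_int (i - 1) *\<^sub>R b) + b)"
    by (simp add: algebra_simps)
  also have "\<dots> = f (x + of_int (i - 1) *\<^sub>R b)"
    using assms unfolding periodic_def by blast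
  finally show ?case
    using step2 by simp
qed simp

lemma periodic_add_int_sum:
  assumes "periodic f" "finite B" "B \<subseteq> Basis"
  shows "f (x + (\<Sum>b\<in>B. of_int (n b) *\<^sub>R b)) = f x"
  using assms(2,3)
proof (induction B)
  case (insert b B)
  have "f (x + (\<Sum>b\<in>insert b B. of_int (n b) *\<^sub>R b)) =
      f ((x + (\<Sum>b\<in>B. of_int (n b) *\<^sub>R b)) + of_int (n b) *\<^sub>R b)"
    using insert by (simp add: algebra_simps)
  then show ?case
    using insert periodic_add_int[OF assms(1)] by simp
qed simp

lemma periodic_representative:
  assumes "periodic f"
  obtains y where "y \<in> unit_cell" "f y = f x"
proof
  \<comment> \<open>Removing the integer part of each coordinate lands in the half-open
    cell.\<close>
  define y where "y = x + (\<Sum>b\<in>Basis. of_int (- \<lfloor>x \<bullet> b\<rfloor>) *\<^sub>R b)"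
  have "y \<bullet> b = x \<bullet> b - of_int \<lfloor>x \<bullet> b\<rfloor>" if "b \<in> Basis" for b
    unfolding y_def inner_add_left inner_sum_left_Basis[OF that] by simp
  then have "0 \<le> y \<bullet> b \<and> y \<bullet> b < 1" if "b \<in> Basis" for b
    using floor_correct[of "x \<bullet> b"] that by simp linarith
  then show "y \<in> unit_cell"
    by (simp add: unit_cell_def)
  show "f y = f x"
    unfolding y_def by (rule periodic_add_int_sum[OF assms finite_Basis order_refl])
qed

lemma unit_cell_subset: "unit_cell \<subseteq> cbox 0 One"
  by (force simp: unit_cell_def mem_box)

lemma box_subset_unit_cell: "box 0 One \<subseteq> unit_cell"
  by (force simp: unit_cell_def mem_box)

lemma periodic_C0_bounded:
  fixes f :: "'a::euclidean_space \<Rightarrow> 'b::real_normed_vector"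
  assumes "f \<in> periodic_C0"
  obtains B where "\<And>x. norm (f x) \<le> B"
proof -
  have "compact (f ` cbox 0 One)"
    using assms by (intro compact_continuous_image)
      (auto simp: periodic_C0_def intro: continuous_on_subset)
  then obtain B where B: "\<forall>x\<in>f ` cbox 0 One. norm x \<le> B"
    using compact_imp_bounded[THEN bounded_iff[THEN iffD1]] by blast
  have "norm (f x) \<le> B" for x
  proof -
    obtain y where "y \<in> unit_cell" "f y = f x"
      using assms by (auto simp: periodic_C0_def intro: periodic_representative[of f x])
    then show ?thesis
      using B unit_cell_subset by force
  qed
  then show thesis
    using that by blast
qed

lemma periodic_C0_attains_sup:
  fixes f :: "'a::euclidean_space \<Rightarrow> real"
  assumes "f \<in> periodic_C0"
  obtains x where "\<And>y. f y \<le> f x"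
proof -
  have "\<exists>x\<in>cbox 0 One. \<forall>y\<in>cbox 0 One. f y \<le> f x"
    using assms by (intro continuous_attains_sup)
      (auto simp: periodic_C0_def box_ne_empty intro: continuous_on_subset)
  then obtain x where x: "\<And>y. y \<in> cbox 0 One \<Longrightarrow> f y \<le> f x"
    by blast
  have "f y \<le> f x" for y
  proof -
    obtain z where "z \<in> unit_cell" "f z = f y"
      using assms by (auto simp: periodic_C0_def intro: periodic_representative[of f y])
    then show ?thesis
      using x[of z] unit_cell_subset by auto
  qed
  then show thesis
    using that by blast
qed

lemma periodic_pd:
  assumes "periodic f" "\<And>x. f differentiable (at x)"
  shows "periodic (pd b f)"
  unfolding periodic_def
proof (intro ballI allI)
  fix e x :: 'a assume "e \<in> Basis"
  then have shift: "(\<lambda>x. f (x + e)) = f"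
    using assms(1) unfolding periodic_def by blast
  have "((\<lambda>x. f (x + e)) has_derivative (\<lambda>v. pd v f (x + e))) (at x)"
    using has_derivative_compose[OF has_derivative_add[OF has_derivative_ident has_derivative_const]
        has_derivative_frechet[OF assms(2)]]
    by simp
  then show "pd b f (x + e) = pd b f x"
    unfolding shift by (rule pd_eqI[symmetric])
qed

lemma periodic_C2_C0: "f \<in> periodic_C2 \<Longrightarrow> f \<in> periodic_C0"
  by (simp add: periodic_C2_def periodic_C0_def class_C2_C1 class_C1_continuous)

section \<open>The strong maximum principle\<close>

lemma has_real_derivative_along_line:
  fixes f :: "'a::euclidean_space \<Rightarrow> real"
  assumes "class_C1 f"
  shows "((\<lambda>t. f (m + t *\<^sub>R b)) has_real_derivative pd b f (m + t *\<^sub>R b)) (at t)"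
proof -
  have line: "((\<lambda>t. m + t *\<^sub>R b) has_derivative (\<lambda>s. s *\<^sub>R b)) (at t)"
    by (auto intro!: derivative_eq_intros)
  have "((\<lambda>t. f (m + t *\<^sub>R b)) has_derivative (\<lambda>s. pd (s *\<^sub>R b) f (m + t *\<^sub>R b))) (at t)"
    using has_derivative_compose[OF line class_C1_has_derivative[OF assms]] .
  moreover have "pd (s *\<^sub>R b) f x = pd b f x * s" for s x
    using linear_cmul[OF has_derivative_linear[OF class_C1_has_derivative[OF assms]]]
    by (simp add: mult.commute)
  ultimately show ?thesis
    by (simp add: has_field_derivative_def)
qed

text \<open>Restriction to the line through \<open>m\<close> in direction \<open>b\<close> leaves a
  one-variable question. The first derivative vanishes at \<open>0\<close>; were the second
  positive, the first would be positive just to the right, and the mean value theorem would give a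
  value above the maximum.\<close>

lemma local_max_pd:
  fixes f :: "'a::euclidean_space \<Rightarrow> real"
  assumes f: "class_C2 f" and b: "b \<in> Basis" and r: "r > 0"
    and max: "\<And>x. dist m x < r \<Longrightarrow> f x \<le> f m"
  shows "pd b f m = 0" and "pd b (pd b f) m \<le> 0"
proof -
  define g where "g t = f (m + t *\<^sub>R b)" for t
  define g' where "g' t = pd b f (m + t *\<^sub>R b)" for t
  have D: "(g has_real_derivative g' t) (at t)" for t
    unfolding g_def g'_def by (rule has_real_derivative_along_line[OF class_C2_C1[OF f]])
  have D': "(g' has_real_derivative pd b (pd b f) (m + t *\<^sub>R b)) (at t)" for t
    unfolding g'_def by (rule has_real_derivative_along_line[OF class_C2_pd[OF f b]])
  have le: "g t \<le> g 0" if "\<bar>t\<bar> < r" for t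
    using max[of "m + t *\<^sub>R b"] that b by (simp add: g_def dist_norm)
  have g'0: "g' 0 = 0"
    using DERIV_local_max[OF D r] le by simp
  then show "pd b f m = 0"
    by (simp add: g'_def)
  show "pd b (pd b f) m \<le> 0"
  proof (rule ccontr)
    assume "\<not> pd b (pd b f) m \<le> 0"
    then have "\<exists>d>0. \<forall>s>0. s < d \<longrightarrow> g' 0 < g' (0 + s)"
      using DERIV_pos_inc_right[OF D'[of 0]] by simp
    then obtain d where d: "d > 0" "\<And>s. 0 < s \<Longrightarrow> s < d \<Longrightarrow> g' s > 0"
      using g'0 by auto
    \<comment> \<open>Below \<open>d\<close>, so that \<open>g'\<close> is positive at the mean
      value point; below \<open>r\<close>, so that \<open>g t\<close> is still bounded by
      \<open>g 0\<close>.\<close>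
    define t where "t = min d r / 2"
    have t: "0 < t" "t < d" "t < r"
      using d r by (auto simp: t_def)
    obtain s where s: "0 < s" "s < t" "g t - g 0 = (t - 0) * g' s"
      using MVT2[OF t(1), of g g'] D by blast
    have "t * g' s > 0"
      using t s d(2)[of s] by simp
    then show False
      using s(3) le[of t] t by simp
  qed
qed

section \<open>The Gaussian and its derivatives\<close>

lemma has_derivative_gaussian:
  fixes z :: "'a::euclidean_space"
  shows "((\<lambda>x. exp (- A * ((x - z) \<bullet> (x - z)))) has_derivative
    (\<lambda>v. (- 2 * A * ((x - z) \<bullet> v)) * exp (- A * ((x - z) \<bullet> (x - z))))) (at x)"
  by (rule derivative_eq_intros refl | simp add: inner_commute algebra_simps)+

lemma gaussian_derivatives:
  fixes z :: "'a::euclidean_space" and A :: real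
  defines "E \<equiv> \<lambda>x. exp (- A * ((x - z) \<bullet> (x - z)))"
  shows "class_C2 E"
    and "pd b E = (\<lambda>x. (- 2 * A * ((x - z) \<bullet> b)) * E x)"
    and "b \<in> Basis \<Longrightarrow> pd b (pd b E) = (\<lambda>x. (4 * A\<^sup>2 * ((x - z) \<bullet> b)\<^sup>2 - 2 * A) * E x)"
proof -
  have C1: "class_C1 E"
    unfolding E_def
    by (rule class_C1I, rule has_derivative_gaussian) (intro continuous_intros)
  show pdE: "pd b E = (\<lambda>x. (- 2 * A * ((x - z) \<bullet> b)) * E x)" for b
    unfolding E_def by (rule ext, rule pd_eqI, rule has_derivative_gaussian)
  have lin: "((\<lambda>x. - 2 * A * ((x - z) \<bullet> b)) has_derivative (\<lambda>v. - 2 * A * (v \<bullet> b))) (at x)" for b x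
    by (auto intro!: derivative_eq_intros)
  have C1_lin: "class_C1 (\<lambda>x. - 2 * A * ((x - z) \<bullet> b))" for b
    by (rule class_C1I, rule lin) (intro continuous_intros)
  show "class_C2 E"
    unfolding class_C2_def pdE
    by (intro conjI ballI C1 class_C1_bilinear[OF bounded_bilinear_mult] C1_lin)
  show "pd b (pd b E) = (\<lambda>x. (4 * A\<^sup>2 * ((x - z) \<bullet> b)\<^sup>2 - 2 * A) * E x)" if "b \<in> Basis"
    unfolding pdE[of b] pd_bilinear[OF bounded_bilinear_mult C1_lin C1] pdE pd_eqI[OF lin]
    using that by (simp add: fun_eq_iff power2_eq_square algebra_simps)
qed

text \<open>A multiple of the Laplacian plus a drift. Zeroth-order and jump terms are kept outside,
  so that constants lie in the kernel; general values let the same operator act on real comparison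
  functions and complex eigenfunctions.\<close>

definition elliptic_op ::
  "real \<Rightarrow> ('a::euclidean_space \<Rightarrow> 'a \<Rightarrow> real) \<Rightarrow> ('a \<Rightarrow> 'b::real_normed_vector) \<Rightarrow> 'a \<Rightarrow> 'b" where
  "elliptic_op \<kappa> \<beta> v p =
    (\<Sum>b\<in>Basis. \<kappa> *\<^sub>R pd b (pd b v) p + \<beta> b p *\<^sub>R pd b v p)"

lemma elliptic_op_const [simp]: "elliptic_op \<kappa> \<beta> (\<lambda>_. k) = (\<lambda>_. 0)"
  by (simp add: elliptic_op_def fun_eq_iff)

lemma elliptic_op_add:
  assumes "class_C2 f" "class_C2 g"
  shows "elliptic_op \<kappa> \<beta> (\<lambda>x. f x + g x) p = elliptic_op \<kappa> \<beta> f p + elliptic_op \<kappa> \<beta> g p"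
  unfolding elliptic_op_def sum.distrib[symmetric]
proof (rule sum.cong[OF refl])
  fix b :: 'a assume "b \<in> Basis"
  then show "\<kappa> *\<^sub>R pd b (pd b (\<lambda>x. f x + g x)) p + \<beta> b p *\<^sub>R pd b (\<lambda>x. f x + g x) p =
      \<kappa> *\<^sub>R pd b (pd b f) p + \<beta> b p *\<^sub>R pd b f p + (\<kappa> *\<^sub>R pd b (pd b g) p + \<beta> b p *\<^sub>R pd b g p)"
    using assms by (simp add: pd_add class_C2_C1 class_C2_pd algebra_simps)
qed

lemma elliptic_op_bounded_linear:
  fixes f :: "'a::euclidean_space \<Rightarrow> 'b::real_normed_vector"
  assumes "bounded_linear L" "class_C2 f"
  shows "elliptic_op \<kappa> \<beta> (\<lambda>x. L (f x)) p = L (elliptic_op \<kappa> \<beta> f p)"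
proof -
  interpret L: bounded_linear L by fact
  show ?thesis
    unfolding elliptic_op_def L.sum
  proof (rule sum.cong[OF refl])
    fix b :: 'a assume b: "b \<in> Basis"
    show "\<kappa> *\<^sub>R pd b (pd b (\<lambda>x. L (f x))) p + \<beta> b p *\<^sub>R pd b (\<lambda>x. L (f x)) p =
        L (\<kappa> *\<^sub>R pd b (pd b f) p + \<beta> b p *\<^sub>R pd b f p)"
      unfolding pd_bounded_linear[OF assms(1) class_C2_C1[OF assms(2)]]
        pd_bounded_linear[OF assms(1) class_C2_pd[OF assms(2) b]]
      by (simp add: L.add L.scaleR)
  qed
qed

lemma elliptic_op_interior_max:
  fixes f :: "'a::euclidean_space \<Rightarrow> real"
  assumes "class_C2 f" "r > 0" "\<And>x. dist m x < r \<Longrightarrow> f x \<le> f m" "\<kappa> \<ge> 0"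
  shows "elliptic_op \<kappa> \<beta> f m \<le> 0"
  unfolding elliptic_op_def
  using local_max_pd[OF assms(1) _ assms(2,3)] assms(4)
  by (intro sum_nonpos) (simp add: mult_nonneg_nonpos)

text \<open>The ball with diameter from \<open>z\<close> to \<open>x0\<close> touches the sphere
  about \<open>z\<close> through \<open>x0\<close> from inside, at \<open>x0\<close> only. With
  \<open>a\<close> and \<open>c\<close> the vectors from its centre to \<open>x\<close> and
  \<open>x0\<close>, the parallelogram law bounds the squared norm of \<open>a - c\<close> by
  \<open>4 * (c \<bullet> c) - 4 * (c \<bullet> c)\<close>.\<close>

lemma touching_ball:
  fixes z x0 x :: "'a::real_inner"
  assumes "dist x ((1/2) *\<^sub>R (z + x0)) \<le> dist z x0 / 2" "dist z x \<ge> dist z x0"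
  shows "x = x0"
proof -
  define a where "a = x - (1/2) *\<^sub>R (z + x0)"
  define c where "c = (1/2) *\<^sub>R (x0 - z)"
  have x0z: "x0 - z = 2 *\<^sub>R c" and xz: "x - z = a + c"
    unfolding a_def c_def by (simp_all add: algebra_simps flip: scaleR_2)
  have d: "dist z x0 = 2 * norm c" "dist z x = norm (a + c)"
    using x0z xz by (simp_all add: dist_norm norm_minus_commute)
  have "norm a \<le> norm c" "2 * norm c \<le> norm (a + c)"
    using assms unfolding d by (simp_all add: a_def dist_norm)
  then have "(norm a)\<^sup>2 \<le> (norm c)\<^sup>2" "(2 * norm c)\<^sup>2 \<le> (norm (a + c))\<^sup>2"
    by (intro power_mono; simp)+
  then have "a \<bullet> a \<le> c \<bullet> c" "4 * (c \<bullet> c) \<le> (a + c) \<bullet> (a + c)"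
    by (simp_all only: power2_norm_eq_inner power_mult_distrib) simp_all
  then have "(a - c) \<bullet> (a - c) \<le> 0"
    by (simp add: inner_diff inner_add inner_commute)
  then have "a = c"
    by (metis antisym inner_eq_zero_iff inner_ge_zero right_minus_eq)
  then show ?thesis
    using x0z xz by (simp add: scaleR_2 algebra_simps)
qed

text \<open>Second derivatives of the Gaussian contribute a term of order \<open>A\<^sup>2\<close>
  times the squared distance to \<open>z\<close>, everything else is of order \<open>A\<close>. Away
  from \<open>z\<close> the first wins for large \<open>A\<close>, with room for a zeroth-order term
  of size \<open>W\<close>; the outer radius keeps the drift term under control.\<close>

lemma gaussian_barrier:
  fixes z :: "'a::euclidean_space"
  assumes "\<kappa> > 0" "\<rho> > 0" and \<beta>: "\<And>b x. b \<in> Basis \<Longrightarrow> \<bar>\<beta> b x\<bar> \<le> B"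
  obtains A where "\<And>x. \<rho> / 2 \<le> dist x z \<Longrightarrow> dist x z \<le> 3 * \<rho> / 2 \<Longrightarrow>
    elliptic_op \<kappa> \<beta> (\<lambda>x. exp (- A * ((x - z) \<bullet> (x - z)))) x > W * exp (- A * ((x - z) \<bullet> (x - z)))"
    and "A > 0"
proof
  define n where "n = real DIM('a)"
  have "n > 0" "B \<ge> 0"
    using \<beta>[OF SOME_Basis] by (auto simp: n_def intro: order_trans[OF abs_ge_zero])
  \<comment> \<open>\<open>K\<close> collects the coefficients of the terms linear in
    \<open>A\<close> on the annulus, and \<open>\<bar>W\<bar> + 1\<close>; the choice of
    \<open>A\<close> below makes \<open>A * \<kappa> * \<rho>\<^sup>2\<close> exceed
    \<open>K\<close>, and \<open>A > 1\<close> lets \<open>A * (\<bar>W\<bar> + 1)\<close> cover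
    \<open>\<bar>W\<bar>\<close>.\<close>
  define K where "K = 2 * \<kappa> * n + 3 * B * n * \<rho> + \<bar>W\<bar> + 1"
  have "K > 0"
    using assms \<open>n > 0\<close> \<open>B \<ge> 0\<close> by (simp add: K_def add_nonneg_pos)
  define A where "A = 1 + K / (\<kappa> * \<rho>\<^sup>2)"
  have "A > 1"
    using assms \<open>K > 0\<close> by (simp add: A_def)
  then show "A > 0" by simp
  have "A * (\<kappa> * \<rho>\<^sup>2) = \<kappa> * \<rho>\<^sup>2 + K"
    using assms by (simp add: A_def field_simps)
  then have "A * (\<kappa> * \<rho>\<^sup>2) > K"
    using assms by simp
  then have "A * (A * (\<kappa> * \<rho>\<^sup>2)) > A * K"
    using \<open>A > 1\<close> by simp
  moreover have "A * K \<ge> A * (2 * \<kappa> * n + 3 * B * n * \<rho>) + \<bar>W\<bar>"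
  proof -
    have "A * (\<bar>W\<bar> + 1) \<ge> 1 * \<bar>W\<bar>"
      using \<open>A > 1\<close> by (intro mult_mono) auto
    then show ?thesis by (simp add: K_def algebra_simps)
  qed
  ultimately have A: "\<kappa> * A\<^sup>2 * \<rho>\<^sup>2 - 2 * \<kappa> * A * n - 3 * A * B * n * \<rho> > W"
    by (simp add: power2_eq_square algebra_simps)
  define E where "E x = exp (- A * ((x - z) \<bullet> (x - z)))" for x
  have pdE: "pd b E = (\<lambda>x. (- 2 * A * ((x - z) \<bullet> b)) * E x)"
    "b \<in> Basis \<Longrightarrow> pd b (pd b E) = (\<lambda>x. (4 * A\<^sup>2 * ((x - z) \<bullet> b)\<^sup>2 - 2 * A) * E x)" for b
    unfolding E_def by (rule gaussian_derivatives, assumption?)+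
  fix x assume x: "\<rho> / 2 \<le> dist x z" "dist x z \<le> 3 * \<rho> / 2"
  have "W < \<kappa> * A\<^sup>2 * \<rho>\<^sup>2 - 2 * \<kappa> * A * n - 3 * A * B * n * \<rho>"
    by (rule A)
  also have "\<dots> = 4 * \<kappa> * A\<^sup>2 * (\<rho> / 2)\<^sup>2 - 2 * \<kappa> * A * n - n * (2 * A * B * (3 * \<rho> / 2))"
    by (simp add: power2_eq_square)
  \<comment> \<open>The quadratic term uses the inner radius of the annulus, the drift term the
    outer one.\<close>
  also have "\<dots> \<le> 4 * \<kappa> * A\<^sup>2 * (norm (x - z))\<^sup>2 - 2 * \<kappa> * A * n - n * (2 * A * B * norm (x - z))"
    using x assms \<open>A > 1\<close> \<open>n > 0\<close> \<open>B \<ge> 0\<close> unfolding dist_norm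
    by (intro diff_mono mult_left_mono power_mono) auto
  also have "\<dots> = (\<Sum>b\<in>Basis. 4 * \<kappa> * A\<^sup>2 * ((x - z) \<bullet> b)\<^sup>2 - 2 * \<kappa> * A - 2 * A * B * norm (x - z))"
    unfolding sum_subtractf n_def power2_norm_eq_inner sum_distrib_left[symmetric]
    by (subst euclidean_inner) (simp add: power2_eq_square)
  also have "\<dots> \<le> (\<Sum>b\<in>Basis. \<kappa> * (4 * A\<^sup>2 * ((x - z) \<bullet> b)\<^sup>2 - 2 * A) + \<beta> b x * (- 2 * A * ((x - z) \<bullet> b)))"
  proof (rule sum_mono)
    fix b :: 'a assume b: "b \<in> Basis"
    have "\<bar>\<beta> b x * ((x - z) \<bullet> b)\<bar> \<le> B * norm (x - z)"
      unfolding abs_mult using \<beta>[OF b] Basis_le_norm[OF b] \<open>B \<ge> 0\<close> by (intro mult_mono) auto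
    then have "2 * A * (\<beta> b x * ((x - z) \<bullet> b)) \<le> 2 * A * (B * norm (x - z))"
      using \<open>A > 1\<close> by (intro mult_left_mono) auto
    then show "4 * \<kappa> * A\<^sup>2 * ((x - z) \<bullet> b)\<^sup>2 - 2 * \<kappa> * A - 2 * A * B * norm (x - z) \<le>
        \<kappa> * (4 * A\<^sup>2 * ((x - z) \<bullet> b)\<^sup>2 - 2 * A) + \<beta> b x * (- 2 * A * ((x - z) \<bullet> b))"
      by (simp add: algebra_simps)
  qed
  finally have "W * E x < (\<Sum>b\<in>Basis. \<kappa> * (4 * A\<^sup>2 * ((x - z) \<bullet> b)\<^sup>2 - 2 * A) + \<beta> b x * (- 2 * A * ((x - z) \<bullet> b))) * E x"
    by (simp add: E_def)
  also have "\<dots> = elliptic_op \<kappa> \<beta> E x"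
    unfolding elliptic_op_def sum_distrib_right
    by (rule sum.cong[OF refl]) (simp only: pdE(2), simp add: pdE(1) algebra_simps)
  finally show "elliptic_op \<kappa> \<beta> (\<lambda>x. exp (- A * ((x - z) \<bullet> (x - z)))) x > W * exp (- A * ((x - z) \<bullet> (x - z)))"
    by (simp add: E_def[abs_def])
qed

text \<open>Hopf's argument: near a zero of \<open>v\<close> closest to a nonzero point, a small
  multiple of the barrier turns \<open>v\<close> into a strict subsolution with an interior maximum,
  which is impossible. The coefficient \<open>w\<close> acts as a killing rate; its bound
  \<open>W\<close> fixes how strong the barrier must be.\<close>

theorem strong_maximum_principle:
  fixes v w :: "'a::euclidean_space \<Rightarrow> real"
  assumes v: "class_C2 v" and \<kappa>: "\<kappa> > 0"
    and \<beta>: "\<And>b x. b \<in> Basis \<Longrightarrow> \<bar>\<beta> b x\<bar> \<le> B"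
    and w: "\<And>x. 0 \<le> w x" "\<And>x. w x \<le> W"
    and sub: "\<And>x. elliptic_op \<kappa> \<beta> v x \<ge> w x * v x"
    and nonpos: "\<And>x. v x \<le> 0" and zero: "v y = 0"
  shows "v x = 0"
proof (rule ccontr)
  assume "v x \<noteq> 0"
  define S where "S = v -` {0}"
  have "continuous_on UNIV v"
    by (rule class_C1_continuous[OF class_C2_C1[OF v]])
  then have "closed S" "S \<noteq> {}" "x \<notin> S"
    using zero \<open>v x \<noteq> 0\<close> continuous_closed_vimage[of "{0}" v]
    by (auto simp: S_def continuous_on_eq_continuous_at)
  obtain x0 where x0: "x0 \<in> S" "\<And>y. y \<in> S \<Longrightarrow> dist x x0 \<le> dist x y"
    using distance_attains_inf[OF \<open>closed S\<close> \<open>S \<noteq> {}\<close>] by blast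
  \<comment> \<open>Halving the ball about \<open>x\<close> leaves a ball whose closure contains no
    zero of \<open>v\<close> except \<open>x0\<close>; the full ball may have several zeros on its
    boundary.\<close>
  define z where "z = (1/2) *\<^sub>R (x + x0)"
  define \<rho> where "\<rho> = dist x x0 / 2"
  have "\<rho> > 0"
    using x0 \<open>x \<notin> S\<close> by (auto simp: \<rho>_def)
  have "dist x0 z = \<rho>"
  proof -
    have "x0 - z = (1/2) *\<^sub>R (x0 - x)"
      by (simp add: z_def algebra_simps) (simp flip: scaleR_add_left)
    then show ?thesis by (simp add: dist_norm \<rho>_def norm_minus_commute)
  qed
  have touch: "y = x0" if "v y = 0" "dist y z \<le> \<rho>" for y
    using that x0(2)[of y] by (intro touching_ball[where z=x]) (auto simp: S_def z_def \<rho>_def)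
  obtain A where "A > 0" and A: "\<And>x. \<rho> / 2 \<le> dist x z \<Longrightarrow> dist x z \<le> 3 * \<rho> / 2 \<Longrightarrow>
    elliptic_op \<kappa> \<beta> (\<lambda>x. exp (- A * ((x - z) \<bullet> (x - z)))) x > W * exp (- A * ((x - z) \<bullet> (x - z)))"
    by (rule gaussian_barrier[OF \<kappa> \<open>\<rho> > 0\<close> \<beta>], assumption, rule that)
  define E where "E x = exp (- A * ((x - z) \<bullet> (x - z)))" for x
  \<comment> \<open>Normalised to vanish on the sphere of radius \<open>\<rho>\<close> about
    \<open>z\<close>, hence at \<open>x0\<close>. The constant does not affect
    \<open>elliptic_op\<close> and only lowers \<open>w y * e y\<close>, so the barrier inequality
    survives.\<close>
  define e where "e x = E x + - exp (- A * \<rho>\<^sup>2)" for x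
  have E: "class_C2 E"
    unfolding E_def by (rule gaussian_derivatives)
  have e: "class_C2 e"
    unfolding e_def by (intro class_C2_add E class_C2_const)
  have E_dist: "E y = exp (- A * (dist y z)\<^sup>2)" for y
    by (simp add: E_def dist_norm power2_norm_eq_inner)
  have e_x0: "e x0 = 0"
    by (simp add: e_def E_dist \<open>dist x0 z = \<rho>\<close>)
  have e_neg: "e y < 0" if "dist y z > \<rho>" for y
    using that \<open>\<rho> > 0\<close> \<open>A > 0\<close> by (simp add: e_def E_dist power_strict_mono)
  have e_sub: "elliptic_op \<kappa> \<beta> e y > w y * e y" if "dist y x0 \<le> \<rho> / 2" for y
  proof -
    \<comment> \<open>Since \<open>x0\<close> is at distance \<open>\<rho>\<close> from
      \<open>z\<close>, the triangle inequality places the small ball about \<open>x0\<close> inside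
      the annulus of the barrier.\<close>
    have "\<rho> / 2 \<le> dist y z" "dist y z \<le> 3 * \<rho> / 2"
      using that \<open>dist x0 z = \<rho>\<close> dist_triangle[of y z x0] dist_triangle[of x0 z y]
      by (simp_all add: dist_commute)
    then have "W * E y < elliptic_op \<kappa> \<beta> E y"
      using A by (simp add: E_def[abs_def])
    also have "\<dots> = elliptic_op \<kappa> \<beta> e y"
      unfolding e_def by (subst elliptic_op_add[OF E class_C2_const]) simp
    finally have "W * E y < elliptic_op \<kappa> \<beta> e y" .
    moreover have "w y * e y \<le> w y * E y" "w y * E y \<le> W * E y"
      using w by (auto simp: e_def E_def intro!: mult_left_mono mult_right_mono)
    ultimately show ?thesis by linarith
  qed
  define K where "K = sphere x0 (\<rho> / 2) \<inter> cball z \<rho>"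
  have "compact K"
    by (simp add: K_def compact_Int_closed)
  have "v y < 0" if "y \<in> K" for y
    using touch[of y] nonpos[of y] that \<open>\<rho> > 0\<close> by (force simp: K_def dist_commute)
  obtain \<eta> where "\<eta> > 0" and \<eta>: "\<And>y. y \<in> K \<Longrightarrow> v y \<le> - \<eta>"
  \<comment> \<open>A negative continuous function on a nonempty compact set stays below a negative
    constant; for empty \<open>K\<close> the bound is vacuous and \<open>1\<close> serves.\<close>
  proof (cases "K = {}")
    case False
    have "continuous_on K v"
      using \<open>continuous_on UNIV v\<close> continuous_on_subset by blast
    then obtain y where "y \<in> K" "\<forall>y'\<in>K. v y' \<le> v y"
      using continuous_attains_sup[OF \<open>compact K\<close> False] by blast
    then show ?thesis
      using that[of "- v y"] \<open>\<And>y. y \<in> K \<Longrightarrow> v y < 0\<close> by auto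
  qed (use that[of 1] in auto)
  \<comment> \<open>Together with \<open>e < 1\<close>, this keeps the perturbation
    \<open>\<delta> * e\<close> below \<open>\<eta>\<close> and so \<open>Q\<close> negative on
    \<open>K\<close>.\<close>
  define \<delta> where "\<delta> = \<eta> / 2"
  have e_le: "e y < 1" for y
  proof -
    have "E y \<le> 1"
      using \<open>A > 0\<close> by (simp add: E_dist)
    then show ?thesis
      using exp_gt_zero[of "- A * \<rho>\<^sup>2"] unfolding e_def by linarith
  qed
  \<comment> \<open>\<open>Q\<close> vanishes at \<open>x0\<close> but is negative on the sphere around it: outside \<open>cball z \<rho>\<close> since
    \<open>e < 0\<close>, inside since that ball meets the zero set of \<open>v\<close> only in \<open>x0\<close>. So \<open>Q\<close> has an interior
    maximum, where it cannot be a strict subsolution.\<close>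
  define Q where "Q y = v y + \<delta> * e y" for y
  have "\<delta> > 0"
    using \<open>\<eta> > 0\<close> by (simp add: \<delta>_def)
  have \<delta>e: "class_C2 (\<lambda>y. \<delta> * e y)"
    by (rule class_C2_bounded_linear[OF bounded_linear_mult_right e])
  have Q: "class_C2 Q"
    unfolding Q_def by (rule class_C2_add[OF v \<delta>e])
  have Q_x0: "Q x0 = 0"
    using x0 e_x0 by (simp add: Q_def S_def)
  have Q_sphere: "Q y < 0" if "dist y x0 = \<rho> / 2" for y
  proof (cases "dist y z > \<rho>")
    case True
    then show ?thesis
      using nonpos[of y] mult_pos_neg[OF \<open>\<delta> > 0\<close> e_neg[OF True]] by (simp add: Q_def)
  next
    case False
    then have "v y \<le> - \<eta>"
      using that by (intro \<eta>) (simp add: K_def dist_commute)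
    moreover have "\<delta> * e y < \<delta> * 1"
      using \<open>\<delta> > 0\<close> e_le by (intro mult_strict_left_mono)
    ultimately show ?thesis
      using \<open>\<eta> > 0\<close> unfolding Q_def \<delta>_def by linarith
  qed
  have "continuous_on (cball x0 (\<rho> / 2)) Q"
    using class_C1_continuous[OF class_C2_C1[OF Q]] continuous_on_subset by blast
  then obtain m where m: "m \<in> cball x0 (\<rho> / 2)" "\<And>y. y \<in> cball x0 (\<rho> / 2) \<Longrightarrow> Q y \<le> Q m"
    using continuous_attains_sup[of "cball x0 (\<rho> / 2)" Q] \<open>\<rho> > 0\<close> by force
  have "Q m \<ge> 0"
    using m(2)[of x0] \<open>\<rho> > 0\<close> Q_x0 by simp
  then have "dist m x0 < \<rho> / 2"
    using Q_sphere[of m] m(1) by (force simp: dist_commute)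
  have "elliptic_op \<kappa> \<beta> Q m \<le> 0"
  proof (rule elliptic_op_interior_max[OF Q])
    show "\<rho> / 2 - dist m x0 > 0"
      using \<open>dist m x0 < \<rho> / 2\<close> by simp
    show "Q y \<le> Q m" if "dist m y < \<rho> / 2 - dist m x0" for y
      using that dist_triangle[of x0 y m] by (intro m(2)) (simp add: dist_commute)
  qed (use \<kappa> in simp)
  moreover have "elliptic_op \<kappa> \<beta> Q m = elliptic_op \<kappa> \<beta> v m + \<delta> * elliptic_op \<kappa> \<beta> e m"
    unfolding Q_def elliptic_op_add[OF v \<delta>e]
    by (simp add: elliptic_op_bounded_linear[OF bounded_linear_mult_right e])
  moreover have "\<delta> * elliptic_op \<kappa> \<beta> e m > \<delta> * (w m * e m)"
    using e_sub[of m] \<open>dist m x0 < \<rho> / 2\<close> \<open>\<delta> > 0\<close> by simp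
  \<comment> \<open>This makes the zeroth-order terms of \<open>v\<close> and
    \<open>\<delta> * e\<close> jointly nonnegative at \<open>m\<close>, so the strict inequality
    for \<open>e\<close> forces \<open>elliptic_op \<kappa> \<beta> Q m > 0\<close>.\<close>
  moreover have "w m * Q m \<ge> 0"
    using w \<open>Q m \<ge> 0\<close> by simp
  then have "w m * v m + \<delta> * (w m * e m) \<ge> 0"
    by (simp add: Q_def algebra_simps)
  ultimately show False
    using sub[of m] by linarith
qed

section \<open>Reversible jumps and diffusion\<close>

lemma periodic_C2_bilinear:
  assumes "bounded_bilinear P" "f \<in> periodic_C2" "g \<in> periodic_C2"
  shows "(\<lambda>x. P (f x) (g x)) \<in> periodic_C2"
  using class_C2_bilinear[OF assms(1), of f g] assms(2,3) by (simp add: periodic_C2_def periodic_def)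

lemma periodic_C2_bounded_linear:
  assumes "bounded_linear L" "f \<in> periodic_C2"
  shows "(\<lambda>x. L (f x)) \<in> periodic_C2"
  using class_C2_bounded_linear[OF assms(1), of f] assms(2) by (simp add: periodic_C2_def periodic_def)

lemma periodic_C2_inverse:
  fixes f :: "'a::euclidean_space \<Rightarrow> real"
  assumes "f \<in> periodic_C2" "\<And>x. f x \<noteq> 0"
  shows "(\<lambda>x. inverse (f x)) \<in> periodic_C2"
  using class_C2_inverse[of f] assms by (simp add: periodic_C2_def periodic_def)

text \<open>The cross terms \<open>2 * \<kappa>\<close> times \<open>pd b h\<close> and
  \<open>pd b u\<close> are absorbed into the drift after factoring out \<open>h\<close>: this is
  the Doob transform of the diffusion.\<close>

lemma elliptic_op_scaleR:
  fixes h :: "'a::euclidean_space \<Rightarrow> real" and u :: "'a \<Rightarrow> 'b::real_normed_vector"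
  assumes "class_C2 h" "class_C2 u" "h p \<noteq> 0"
  shows "elliptic_op \<kappa> a (\<lambda>p. h p *\<^sub>R u p) p =
    h p *\<^sub>R elliptic_op \<kappa> (\<lambda>b p. a b p + 2 * \<kappa> * pd b h p / h p) u p + elliptic_op \<kappa> a h p *\<^sub>R u p"
  unfolding elliptic_op_def scaleR_sum_right scaleR_sum_left sum.distrib[symmetric]
proof (rule sum.cong[OF refl])
  fix b :: 'a assume b: "b \<in> Basis"
  show "\<kappa> *\<^sub>R pd b (pd b (\<lambda>p. h p *\<^sub>R u p)) p + a b p *\<^sub>R pd b (\<lambda>p. h p *\<^sub>R u p) p =
    h p *\<^sub>R (\<kappa> *\<^sub>R pd b (pd b u) p + (a b p + 2 * \<kappa> * pd b h p / h p) *\<^sub>R pd b u p) +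
    (\<kappa> *\<^sub>R pd b (pd b h) p + a b p *\<^sub>R pd b h p) *\<^sub>R u p"
    unfolding pd_pd_bilinear[OF bounded_bilinear_scaleR assms(1,2) b]
    unfolding pd_bilinear[OF bounded_bilinear_scaleR class_C2_C1[OF assms(1)] class_C2_C1[OF assms(2)]]
    using assms(3) by (simp add: algebra_simps)
qed

text \<open>The last sum is the carre du champ. With the real inner product on
  \<open>complex\<close>, \<open>u p \<bullet> u p\<close> is the squared modulus, a real function
  to which the maximum principle applies.\<close>

lemma elliptic_op_inner_self:
  fixes u :: "'a::euclidean_space \<Rightarrow> 'b::real_inner"
  assumes "class_C2 u"
  shows "elliptic_op \<kappa> \<beta> (\<lambda>p. u p \<bullet> u p) p =
    2 * (u p \<bullet> elliptic_op \<kappa> \<beta> u p) + 2 * \<kappa> * (\<Sum>b\<in>Basis. pd b u p \<bullet> pd b u p)"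
  unfolding elliptic_op_def inner_sum_right sum_distrib_left sum.distrib[symmetric]
proof (rule sum.cong[OF refl])
  fix b :: 'a assume b: "b \<in> Basis"
  show "\<kappa> *\<^sub>R pd b (pd b (\<lambda>p. u p \<bullet> u p)) p + \<beta> b p *\<^sub>R pd b (\<lambda>p. u p \<bullet> u p) p =
    2 * (u p \<bullet> (\<kappa> *\<^sub>R pd b (pd b u) p + \<beta> b p *\<^sub>R pd b u p)) + 2 * \<kappa> * (pd b u p \<bullet> pd b u p)"
    unfolding pd_pd_bilinear[OF bounded_bilinear_inner assms assms b]
    unfolding pd_bilinear[OF bounded_bilinear_inner class_C2_C1[OF assms] class_C2_C1[OF assms]]
    by (simp add: inner_add_right inner_commute algebra_simps)
qed

text \<open>Abstract form of the product problem: \<open>\<sigma>\<close> stands for the swap,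
  \<open>w\<close> for the acceptance probability, \<open>q\<close> for the zeroth-order terms. The
  potential enters through \<open>h_eigen\<close> alone, so dividing by \<open>h\<close> leaves only
  the number \<open>\<mu>\<close>.\<close>

locale jump_diffusion =
  fixes \<kappa> W \<mu> :: real and a :: "'a::euclidean_space \<Rightarrow> 'a \<Rightarrow> real" and q w h :: "'a \<Rightarrow> real"
    and \<sigma> :: "'a \<Rightarrow> 'a"
  assumes \<kappa>_pos: "\<kappa> > 0"
    and a_C0: "\<And>b. b \<in> Basis \<Longrightarrow> a b \<in> periodic_C0"
    and w_nonneg: "\<And>p. 0 \<le> w p" and w_le: "\<And>p. w p \<le> W"
    and detailed_balance: "\<And>p. w (\<sigma> p) * h (\<sigma> p) = w p * h p"
    and h_C2: "h \<in> periodic_C2" and h_pos: "\<And>p. h p > 0"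
    and h_eigen: "\<And>p. - elliptic_op \<kappa> a h p + q p * h p = \<mu> * h p"
begin

text \<open>The jump part is minus the formal adjoint of the operator taking \<open>f\<close> to
  \<open>w p *\<^sub>R (f (\<sigma> p) - f p)\<close> when \<open>\<sigma>\<close> is a
  measure-preserving involution; hence \<open>w\<close> is evaluated at \<open>\<sigma> p\<close> in
  its last term.\<close>

definition full_op :: "('a \<Rightarrow> 'b::real_normed_vector) \<Rightarrow> 'a \<Rightarrow> 'b" where
  "full_op f p = - elliptic_op \<kappa> a f p + q p *\<^sub>R f p + (w p *\<^sub>R f p - w (\<sigma> p) *\<^sub>R f (\<sigma> p))"

text \<open>The added term is \<open>2 * \<kappa>\<close> times the logarithmic derivative of
  \<open>h\<close>.\<close>

definition drift :: "'a \<Rightarrow> 'a \<Rightarrow> real" where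
  "drift b p = a b p + 2 * \<kappa> * pd b h p / h p"

definition gen :: "('a \<Rightarrow> 'b::real_normed_vector) \<Rightarrow> 'a \<Rightarrow> 'b" where
  "gen u p = elliptic_op \<kappa> drift u p + w p *\<^sub>R (u (\<sigma> p) - u p)"

lemma gen_const [simp]: "gen (\<lambda>_. k) p = 0"
  by (simp add: gen_def)

lemma gen_bounded_linear:
  assumes "bounded_linear L" "class_C2 u"
  shows "gen (\<lambda>p. L (u p)) p = L (gen u p)"
proof -
  interpret L: bounded_linear L by fact
  show ?thesis
    by (simp add: gen_def elliptic_op_bounded_linear[OF assms] L.add L.diff L.scaleR)
qed

text \<open>\<open>h_eigen\<close> turns the terms without derivatives of \<open>u\<close> into
  \<open>\<mu>\<close>, and detailed balance replaces the weight at \<open>\<sigma> p\<close> by the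
  one at \<open>p\<close>, so the adjoint jump term becomes a genuine jump generator.\<close>

lemma full_op_scaleR:
  assumes "class_C2 u"
  shows "full_op (\<lambda>p. h p *\<^sub>R u p) p = h p *\<^sub>R (\<mu> *\<^sub>R u p - gen u p)"
proof -
  have "class_C2 h" "h p \<noteq> 0"
    using h_C2 h_pos[of p] by (auto simp: periodic_C2_def)
  then have "full_op (\<lambda>p. h p *\<^sub>R u p) p = - (h p *\<^sub>R elliptic_op \<kappa> drift u p)
      + (- elliptic_op \<kappa> a h p + q p * h p) *\<^sub>R u p
      + ((w p * h p) *\<^sub>R u p - (w (\<sigma> p) * h (\<sigma> p)) *\<^sub>R u (\<sigma> p))"
    unfolding full_op_def drift_def[abs_def]
    by (simp add: elliptic_op_scaleR[OF _ assms] algebra_simps)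
  then show ?thesis
    unfolding h_eigen detailed_balance by (simp add: gen_def algebra_simps)
qed

lemma drift_bounded:
  obtains B where "\<And>b p. b \<in> Basis \<Longrightarrow> \<bar>drift b p\<bar> \<le> B"
proof -
  have "\<exists>B. \<forall>p. \<bar>drift b p\<bar> \<le> B" if b: "b \<in> Basis" for b
  proof -
    have h: "class_C1 h" "periodic h"
      using h_C2 by (auto simp: periodic_C2_def class_C2_C1)
    have "h p \<noteq> 0" for p
      using h_pos[of p] by simp
    then have "continuous_on UNIV (drift b)"
      unfolding drift_def using a_C0[OF b] class_C1_continuous[OF h(1)] class_C1_continuous_pd[OF h(1) b]
      by (intro continuous_intros) (auto simp: periodic_C0_def)
    moreover have "periodic (drift b)"
      using a_C0[OF b] h(2) periodic_pd[OF h(2) class_C1_differentiable[OF h(1)], of b]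
      by (simp add: drift_def periodic_C0_def periodic_def)
    ultimately have "drift b \<in> periodic_C0"
      by (simp add: periodic_C0_def)
    then show ?thesis
      by (metis periodic_C0_bounded real_norm_def)
  qed
  then obtain B where B: "\<And>b p. b \<in> Basis \<Longrightarrow> \<bar>drift b p\<bar> \<le> B b"
    by metis
  have "\<bar>drift b p\<bar> \<le> Max (B ` Basis)" if "b \<in> Basis" for b p
    by (rule order_trans[OF B[OF that] Max_ge]) (use that in auto)
  then show thesis
    by (rule that)
qed

text \<open>After subtracting its maximum \<open>v\<close> is nonpositive, and a jump can gain at
  most the distance to the maximum. The nonlocal term is thus dominated by a killing term, and the
  local maximum principle applies.\<close>

lemma gen_nonneg_imp_constant:
  fixes v :: "'a \<Rightarrow> real"
  assumes v: "v \<in> periodic_C2" and nonneg: "\<And>p. gen v p \<ge> 0"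
  obtains k where "v = (\<lambda>_. k)"
proof -
  obtain m where m: "\<And>p. v p \<le> v m"
    using periodic_C0_attains_sup[OF periodic_C2_C0[OF v]] by blast
  obtain B where B: "\<And>b p. b \<in> Basis \<Longrightarrow> \<bar>drift b p\<bar> \<le> B"
    using drift_bounded by blast
  define v' where "v' p = v p + - v m" for p
  have C2: "class_C2 v"
    using v by (simp add: periodic_C2_def)
  have "v' p = 0" for p
  proof (rule strong_maximum_principle[where v=v' and y=m, OF _ \<kappa>_pos B w_nonneg w_le])
    show "class_C2 v'"
      unfolding v'_def by (intro class_C2_add C2 class_C2_const)
    show "w p * v' p \<le> elliptic_op \<kappa> drift v' p" for p
    proof -
      have "elliptic_op \<kappa> drift v' p = elliptic_op \<kappa> drift v p"
        unfolding v'_def by (subst elliptic_op_add[OF C2 class_C2_const]) simp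
      moreover have "w p * (v (\<sigma> p) - v p) \<le> w p * - v' p"
        using m[of "\<sigma> p"] w_nonneg by (intro mult_left_mono) (auto simp: v'_def)
      ultimately show ?thesis
        using nonneg[of p] by (simp add: gen_def)
    qed
    show "v' p \<le> 0" for p
      using m[of p] by (simp add: v'_def)
    show "v' m = 0"
      by (simp add: v'_def)
  qed
  then show thesis
    by (intro that[of "v m"] ext) (simp add: v'_def)
qed

text \<open>For real functions, according to the sign of the constant, either \<open>v\<close> or
  \<open>- v\<close> satisfies the hypothesis of the maximum principle; real and imaginary parts
  then give the complex case.\<close>

lemma gen_eq_const_imp_constant:
  fixes u :: "'a \<Rightarrow> complex"
  assumes u: "u \<in> periodic_C2" and k: "\<And>p. gen u p = k"
  obtains k' where "u = (\<lambda>_. k')"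
proof -
  have *: "\<exists>k'. v = (\<lambda>_. k')" if v: "v \<in> periodic_C2" and k: "\<And>p. gen v p = k" for v :: "'a \<Rightarrow> real" and k
  proof (cases "k \<ge> 0")
    case True
    then show ?thesis
      using gen_nonneg_imp_constant[OF v] k by metis
  next
    case False
    have "gen (\<lambda>p. - v p) p \<ge> 0" for p
      using gen_bounded_linear[OF bounded_linear_minus[OF bounded_linear_ident], of v p] v False
      unfolding k by (simp add: periodic_C2_def)
    then obtain k' where "(\<lambda>p. - v p) = (\<lambda>_. k')"
      using gen_nonneg_imp_constant[OF periodic_C2_bounded_linear[OF
            bounded_linear_minus[OF bounded_linear_ident] v]] by metis
    then show ?thesis
      by (intro exI[of _ "- k'"]) (metis minus_minus)
  qed
  have C2: "class_C2 u"
    using u by (simp add: periodic_C2_def)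
  obtain k1 where "(\<lambda>p. Re (u p)) = (\<lambda>_. k1)"
    using *[OF periodic_C2_bounded_linear[OF bounded_linear_Re u], of "Re k"]
      gen_bounded_linear[OF bounded_linear_Re C2] k by auto
  moreover obtain k2 where "(\<lambda>p. Im (u p)) = (\<lambda>_. k2)"
    using *[OF periodic_C2_bounded_linear[OF bounded_linear_Im u], of "Im k"]
      gen_bounded_linear[OF bounded_linear_Im C2] k by auto
  ultimately have "u p = Complex k1 k2" for p
    by (simp add: complex_eq_iff fun_eq_iff)
  then show thesis
    by (intro that[of "Complex k1 k2"] ext)
qed

text \<open>The jump contribution is the finite-difference carre du champ: a difference of squared
  moduli is twice the inner product of \<open>u p\<close> with the increment, plus the squared
  increment.\<close>

lemma gen_inner_self:
  fixes u :: "'a \<Rightarrow> 'b::real_inner"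
  assumes "class_C2 u"
  shows "gen (\<lambda>p. u p \<bullet> u p) p = 2 * (u p \<bullet> gen u p) +
    (2 * \<kappa> * (\<Sum>b\<in>Basis. pd b u p \<bullet> pd b u p) + w p * ((u (\<sigma> p) - u p) \<bullet> (u (\<sigma> p) - u p)))"
  unfolding gen_def elliptic_op_inner_self[OF assms]
  by (simp add: inner_add_right inner_diff inner_commute algebra_simps)

lemma gen_eigenvalue:
  fixes u :: "'a \<Rightarrow> complex"
  assumes u: "u \<in> periodic_C2" and ev: "\<And>p. gen u p = - (z * u p)" and "u x \<noteq> 0" "Re z \<le> 0"
  shows "z = 0"
proof -
  have C2: "class_C2 u"
    using u by (simp add: periodic_C2_def)
  define \<Gamma> where "\<Gamma> p = 2 * \<kappa> * (\<Sum>b\<in>Basis. pd b u p \<bullet> pd b u p)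
    + w p * ((u (\<sigma> p) - u p) \<bullet> (u (\<sigma> p) - u p))" for p
  have *: "gen (\<lambda>p. u p \<bullet> u p) p = - 2 * Re z * (u p \<bullet> u p) + \<Gamma> p" for p
  proof -
    \<comment> \<open>The real inner product of \<open>u p\<close> with \<open>z * u p\<close> sees
      only \<open>Re z\<close>.\<close>
    have "u p \<bullet> gen u p = - Re z * (u p \<bullet> u p)"
      unfolding ev by (simp add: inner_complex_def algebra_simps)
    then show ?thesis
      unfolding gen_inner_self[OF C2] \<Gamma>_def by simp
  qed
  have sq: "0 \<le> 2 * \<kappa> * (\<Sum>b\<in>Basis. pd b u p \<bullet> pd b u p)" for p
    using \<kappa>_pos by (simp add: sum_nonneg)
  have \<Gamma>: "2 * \<kappa> * (\<Sum>b\<in>Basis. pd b u p \<bullet> pd b u p) \<le> \<Gamma> p" for p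
    using w_nonneg by (simp add: \<Gamma>_def)
  have nonneg: "- 2 * Re z * (u p \<bullet> u p) \<ge> 0" for p
    using \<open>Re z \<le> 0\<close> by (simp add: mult_nonpos_nonneg)
  have "(\<lambda>p. u p \<bullet> u p) \<in> periodic_C2"
    by (rule periodic_C2_bilinear[OF bounded_bilinear_inner u u])
  moreover have "gen (\<lambda>p. u p \<bullet> u p) p \<ge> 0" for p
    using *[of p] nonneg[of p] sq[of p] \<Gamma>[of p] by linarith
  ultimately obtain k where "(\<lambda>p. u p \<bullet> u p) = (\<lambda>_. k)"
    by (rule gen_nonneg_imp_constant)
  then have gen_0: "gen (\<lambda>p. u p \<bullet> u p) p = 0" for p
    by simp
  \<comment> \<open>The generator vanishes on the constant squared modulus, and it is a sum of
    nonnegative terms, so each of them is zero.\<close>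
  have "2 * \<kappa> * (\<Sum>b\<in>Basis. pd b u p \<bullet> pd b u p) = 0" for p
    using gen_0[of p] *[of p] nonneg[of p] sq[of p] \<Gamma>[of p] by linarith
  then have "pd b u p = 0" if "b \<in> Basis" for b p
    using that \<kappa>_pos by (auto simp: sum_nonneg_eq_0_iff)
  then obtain k where "u = (\<lambda>_. k)"
    using constant_if_pd_eq_0[OF class_C2_C1[OF C2]] by blast
  then show "z = 0"
    using ev[of x] \<open>u x \<noteq> 0\<close> by simp
qed

section \<open>Spectral conclusions for the operator with jumps\<close>

lemma ground_state_quotient:
  assumes "f \<in> periodic_C2"
  obtains u where "u \<in> periodic_C2" "f = (\<lambda>p. h p *\<^sub>R u p)"
proof
  have nz: "h p \<noteq> 0" for p
    using h_pos[of p] by simp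
  show "(\<lambda>p. inverse (h p) *\<^sub>R f p) \<in> periodic_C2"
    by (rule periodic_C2_bilinear[OF bounded_bilinear_scaleR periodic_C2_inverse[OF h_C2 nz] assms])
  show "f = (\<lambda>p. h p *\<^sub>R inverse (h p) *\<^sub>R f p)"
    using nz by simp
qed

text \<open>\<open>k = 0\<close> describes the eigenspace; general \<open>k\<close> is the second
  step of a Jordan chain. In terms of the quotient by \<open>h\<close> the hypothesis says that
  \<open>gen\<close> is constant, which happens only for constant quotients.\<close>

lemma eigenfunction_up_to_constant:
  fixes f :: "'a \<Rightarrow> complex"
  assumes f: "f \<in> periodic_C2" and k: "\<And>p. full_op f p - \<mu> *\<^sub>R f p = k * of_real (h p)"
  obtains k' where "f = (\<lambda>p. k' * of_real (h p))"
proof -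
  obtain u where u: "u \<in> periodic_C2" "f = (\<lambda>p. h p *\<^sub>R u p)"
    using ground_state_quotient[OF f] by blast
  then have C2: "class_C2 u"
    by (simp add: periodic_C2_def)
  have "gen u p = - k" for p
  proof -
    have "h p *\<^sub>R (- gen u p) = h p *\<^sub>R k"
      using k[of p] unfolding u(2) full_op_scaleR[OF C2]
      by (simp add: algebra_simps scaleR_conv_of_real)
    then have "- gen u p = k"
      using h_pos[of p] by (simp only: scaleR_cancel_left) auto
    then show ?thesis
      by (metis minus_minus)
  qed
  then obtain k' where "u = (\<lambda>_. k')"
    using gen_eq_const_imp_constant[OF u(1)] by metis
  then show thesis
    using u(2) by (intro that[of k']) (simp add: scaleR_conv_of_real mult.commute)
qed

text \<open>Agreement is asked on \<open>periodic_C2\<close>, where eigenfunctions and intermediate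
  iterates live, so that \<open>M\<close> may be given through \<open>torus_adjoint\<close> and
  still be computed with the explicit \<open>full_op\<close>.\<close>

theorem dominant_pair_h:
  assumes M: "\<And>f p. f \<in> periodic_C2 \<Longrightarrow> M f p = full_op f p"
  shows "dominant_pair M h \<mu>"
proof -
  have h_complex: "(\<lambda>p. complex_of_real (h p)) \<in> periodic_C2"
    by (rule periodic_C2_bounded_linear[OF bounded_linear_of_real h_C2])
  have "full_op (\<lambda>p. complex_of_real (h p)) p = of_real \<mu> * of_real (h p)" for p
    using full_op_scaleR[OF class_C2_const, of "1 :: complex" p] by (simp add: scaleR_conv_of_real)
  then have eig: "eigenpair M (\<lambda>p. complex_of_real (h p)) (complex_of_real \<mu>)"
    using h_complex h_pos M[OF h_complex] by (auto simp: eigenpair_def fun_eq_iff) (metis less_irrefl)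
  define T where "T = (\<lambda>u x. M u x - complex_of_real \<mu> * u x)"
  have simple: "\<exists>k. f = (\<lambda>p. k * of_real (h p))"
    if "\<forall>j<n. (T ^^ j) f \<in> periodic_C2" "(T ^^ n) f = (\<lambda>_. 0)" for n f
    using that
  proof (induction n arbitrary: f)
    case 0
    then show ?case by (intro exI[of _ 0]) simp
  next
    case (Suc n)
    have f: "f \<in> periodic_C2"
      using Suc.prems(1)[rule_format, of 0] by simp
    \<comment> \<open>Peeling off the innermost \<open>T\<close> leaves a shorter chain starting at
      \<open>T f\<close>, so the induction hypothesis makes \<open>T f\<close> a multiple of
      \<open>h\<close>.\<close>
    have "\<exists>k. T f = (\<lambda>p. k * of_real (h p))"
    proof (rule Suc.IH)
      show "\<forall>j<n. (T ^^ j) (T f) \<in> periodic_C2"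
        using Suc.prems(1) by (metis Suc_mono comp_apply funpow_Suc_right)
      show "(T ^^ n) (T f) = (\<lambda>_. 0)"
        using Suc.prems(2) by (simp add: funpow_Suc_right del: funpow.simps)
    qed
    then obtain k where k: "T f = (\<lambda>p. k * of_real (h p))"
      by blast
    have "full_op f p - \<mu> *\<^sub>R f p = k * of_real (h p)" for p
    proof -
      have "T f p = k * of_real (h p)"
        by (simp add: k)
      then show ?thesis
        using M[OF f, of p] by (simp add: T_def scaleR_conv_of_real)
    qed
    then show ?case
      using eigenfunction_up_to_constant[OF f] by metis
  qed
  have one_dim: "\<exists>k. f = (\<lambda>p. k * of_real (h p))" if "eigenpair M f (of_real \<mu>)" for f
    using simple[of 1 f] that by (simp add: T_def eigenpair_def)
  have "simple_eigenvalue M (of_real \<mu>)"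
    unfolding simple_eigenvalue_def generalized_eigenfunction_def Let_def T_def[symmetric]
    using eig simple by blast
  moreover have "\<forall>\<gamma> f. eigenpair M f \<gamma> \<and> \<gamma> \<noteq> of_real \<mu> \<longrightarrow> Re \<gamma> > \<mu>"
  proof (intro allI impI, elim conjE, rule ccontr)
    fix \<gamma> f assume f: "eigenpair M f \<gamma>" and ne: "\<gamma> \<noteq> of_real \<mu>" and "\<not> Re \<gamma> > \<mu>"
    have "f \<in> periodic_C2"
      using f by (simp add: eigenpair_def)
    then obtain u where u: "u \<in> periodic_C2" "f = (\<lambda>p. h p *\<^sub>R u p)"
      using ground_state_quotient by blast
    have "gen u p = - ((\<gamma> - of_real \<mu>) * u p)" for p
    proof -
      have "class_C2 u"
        using u(1) by (simp add: periodic_C2_def)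
      then have "h p *\<^sub>R (\<mu> *\<^sub>R u p - gen u p) = full_op f p"
        by (simp only: u(2) full_op_scaleR)
      also have "\<dots> = \<gamma> * f p"
        using f M[OF \<open>f \<in> periodic_C2\<close>, of p] by (simp add: eigenpair_def)
      also have "\<dots> = h p *\<^sub>R (\<gamma> * u p)"
        by (simp add: u(2))
      finally have "h p *\<^sub>R (\<mu> *\<^sub>R u p - gen u p) = h p *\<^sub>R (\<gamma> * u p)" .
      then have "\<mu> *\<^sub>R u p - gen u p = \<gamma> * u p"
        using h_pos[of p] by simp
      then show ?thesis
        by (simp add: algebra_simps scaleR_conv_of_real)
    qed
    moreover obtain x where "u x \<noteq> 0"
      using f u(2) by (auto simp: eigenpair_def fun_eq_iff)
    ultimately have "\<gamma> - of_real \<mu> = 0"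
      using \<open>\<not> Re \<gamma> > \<mu>\<close> by (intro gen_eigenvalue[OF u(1)]) auto
    then show False
      using ne by simp
  qed
  moreover have "\<exists>k>0. g = (\<lambda>x. k * h x)"
    if g: "eigenpair M (\<lambda>x. complex_of_real (g x)) (of_real \<mu>)" "\<forall>x. g x > 0" for g
  proof -
    obtain k where k: "(\<lambda>x. complex_of_real (g x)) = (\<lambda>p. k * of_real (h p))"
      using one_dim[OF g(1)] by blast
    \<comment> \<open>\<open>k\<close> is a priori complex; since \<open>g\<close> and
      \<open>h\<close> are real, its real part is the factor wanted.\<close>
    have "g x = Re k * h x" for x
      using arg_cong[OF fun_cong[OF k, of x], of Re] by simp
    moreover from this have "Re k > 0"
      using g(2) h_pos by (metis zero_less_mult_pos2)
    ultimately show ?thesis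
      by blast
  qed
  ultimately show ?thesis
    unfolding dominant_pair_def using eig h_pos by blast
qed

end

section \<open>The adjoint of the swap operator\<close>

lemma unit_cell_sets [measurable]: "unit_cell \<in> sets borel"
proof -
  have "unit_cell = (\<Inter>b\<in>Basis. {x::'a. 0 \<le> x \<bullet> b} \<inter> {x. x \<bullet> b < 1})"
    by (auto simp: unit_cell_def)
  also have "\<dots> \<in> sets borel"
    by (intro sets.finite_INT sets.Int borel_closed borel_open closed_Collect_le open_Collect_less)
      (auto intro!: continuous_intros)
  finally show ?thesis .
qed

lemma set_integrable_unit_cell:
  fixes f :: "'a::euclidean_space \<Rightarrow> 'b::euclidean_space"
  assumes "continuous_on UNIV f"
  shows "set_integrable lborel unit_cell f"
proof (rule set_integrable_subset[OF _ _ unit_cell_subset])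
  show "set_integrable lborel (cbox 0 One) f"
    unfolding set_integrable_def
    by (intro borel_integrable_compact compact_cbox continuous_on_subset[OF assms]) auto
qed simp

text \<open>The swap preserves the cell and, by Fubini, the product Lebesgue measure.\<close>

lemma set_integral_unit_cell_swap:
  fixes f :: "'a::euclidean_space \<times> 'a \<Rightarrow> 'b::euclidean_space"
  assumes "continuous_on UNIV f"
  shows "(LINT p:unit_cell|lborel. f (prod.swap p)) = (LINT p:unit_cell|lborel. f p)"
proof -
  define F where "F p = indicator unit_cell p *\<^sub>R f p" for p
  have "prod.swap p \<in> unit_cell \<longleftrightarrow> p \<in> unit_cell" for p :: "'a \<times> 'a"
    by (cases p) (auto simp: unit_cell_def Basis_prod_def ball_Un)
  then have indicator_swap: "indicator unit_cell p *\<^sub>R f (prod.swap p) = F (prod.swap p)" for p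
    by (simp add: F_def indicator_def)
  have "F \<in> borel_measurable (lborel \<Otimes>\<^sub>M lborel)"
    using assms unfolding F_def lborel_prod
    by (intro borel_measurable_scaleR borel_measurable_indicator) (auto intro: borel_measurable_continuous_onI)
  from lborel_pair.integral_product_swap[OF this]
  have integral_swap: "(LINT p|lborel. F (prod.swap p)) = (LINT p|lborel. F p)"
    unfolding lborel_prod by (simp add: case_prod_beta' prod.swap_def)
  show ?thesis
    unfolding set_lebesgue_integral_def indicator_swap integral_swap by (simp add: F_def[abs_def])
qed

text \<open>Definiteness on continuous periodic functions, which gives uniqueness of the adjoint.
  The squared modulus has integral zero over the open box, hence over the closed cube, so by
  continuity it vanishes on the cube; periodicity extends this to all points.\<close>

lemma L2_inner_self_eq_0:
  assumes d: "d \<in> periodic_C0" and 0: "L2_inner d d = 0"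
  shows "d = (\<lambda>_. 0)"
proof
  fix x
  have cont: "continuous_on UNIV d"
    using d by (simp add: periodic_C0_def)
  define n where "n x = (norm (d x))\<^sup>2" for x
  have n: "continuous_on UNIV n"
    unfolding n_def by (intro continuous_intros cont)
  have "L2_inner d d = of_real (LINT x:unit_cell|lborel. n x)"
    unfolding L2_inner_def set_integral_complex_of_real[symmetric] n_def complex_norm_square ..
  then have int_0: "(LINT x:unit_cell|lborel. n x) = 0"
    using 0 by simp
  have box: "set_integrable lborel (box 0 One) n"
    by (rule set_integrable_subset[OF set_integrable_unit_cell[OF n] _ box_subset_unit_cell]) simp
  have "(LINT x:box 0 One|lborel. n x) \<le> (LINT x:unit_cell|lborel. n x)"
    using box set_integrable_unit_cell[OF n] box_subset_unit_cell
    unfolding set_lebesgue_integral_def set_integrable_def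
    by (intro integral_mono) (auto simp: indicator_def n_def)
  moreover have "(LINT x:box 0 One|lborel. n x) \<ge> 0"
    unfolding set_lebesgue_integral_def by (intro integral_nonneg_AE) (simp add: n_def)
  ultimately have "integral (cbox 0 One) n = 0"
    using int_0 set_borel_integral_eq_integral(2)[OF box] by (simp add: integral_open_interval)
  then have n0: "(n has_integral 0) (cbox 0 One)"
    using integrable_continuous[OF continuous_on_subset[OF n]] by (metis integrable_integral subset_UNIV)
  obtain y where y: "y \<in> unit_cell" "d y = d x"
    using d by (auto simp: periodic_C0_def intro: periodic_representative[of d x])
  have "n y = 0"
  proof (rule has_integral_0_cbox_imp_0[OF _ _ n0])
    show "continuous_on (cbox 0 One) n"
      using n continuous_on_subset by blast
    show "y \<in> cbox 0 One"
      using y unit_cell_subset by blast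
  qed (auto simp: n_def box_ne_empty)
  then show "d x = 0"
    using y by (simp add: n_def)
qed

lemma periodic_swap:
  fixes f :: "'a::euclidean_space \<times> 'a \<Rightarrow> 'b"
  assumes "periodic f"
  shows "periodic (\<lambda>p. f (prod.swap p))"
  unfolding periodic_def
proof (intro ballI allI)
  fix b p :: "'a \<times> 'a" assume "b \<in> Basis"
  then have "prod.swap b \<in> Basis"
    by (auto simp: Basis_prod_def)
  moreover have "prod.swap (p + b) = prod.swap p + prod.swap b"
    by (simp add: prod_eq_iff)
  ultimately show "f (prod.swap (p + b)) = f (prod.swap p)"
    using assms unfolding periodic_def by metis
qed

lemma continuous_on_swap_compose:
  fixes f :: "'a::euclidean_space \<times> 'a \<Rightarrow> 'b::topological_space"
  assumes "continuous_on UNIV f"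
  shows "continuous_on UNIV (\<lambda>p. f (prod.swap p))"
  by (rule continuous_on_compose2[OF assms continuous_on_swap]) auto

text \<open>The change of variables by the swap moves it from \<open>f\<close> onto the product of
  \<open>w\<close> and \<open>g\<close>. Uniqueness in the definite description follows by testing
  the difference of two candidates against itself.\<close>

lemma torus_adjoint_swap:
  fixes w :: "'a::euclidean_space \<times> 'a \<Rightarrow> real" and g :: "'a \<times> 'a \<Rightarrow> complex"
  assumes w: "w \<in> periodic_C0" and g: "g \<in> periodic_C0"
  shows "torus_adjoint (\<lambda>f p. w p *\<^sub>R (f (prod.swap p) - f p)) g =
    (\<lambda>p. w (prod.swap p) *\<^sub>R g (prod.swap p) - w p *\<^sub>R g p)"
  (is "torus_adjoint ?A g = ?k")
  unfolding torus_adjoint_def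
proof (rule the_equality)
  note cont = continuous_on_swap_compose[where 'b=real] continuous_on_swap_compose[where 'b=complex]
  have wc: "continuous_on UNIV w" and gc: "continuous_on UNIV g"
    and wp: "periodic w" and gp: "periodic g"
    using w g by (auto simp: periodic_C0_def)
  have "continuous_on UNIV ?k"
    by (intro continuous_intros cont wc gc)
  moreover have "periodic ?k"
    using periodic_swap[OF wp] periodic_swap[OF gp] wp gp by (simp add: periodic_def)
  ultimately have k: "?k \<in> periodic_C0"
    by (simp add: periodic_C0_def)
  have adj: "L2_inner (?A f) g = L2_inner f ?k" if "f \<in> periodic_C0" for f
  proof -
    have fc: "continuous_on UNIV f"
      using that by (simp add: periodic_C0_def)
    define F where "F p = w (prod.swap p) *\<^sub>R (f p * cnj (g (prod.swap p)))" for p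
    define G where "G p = w p *\<^sub>R (f p * cnj (g p))" for p
    have F: "continuous_on UNIV F" and G: "continuous_on UNIV G"
      unfolding F_def G_def by (intro continuous_intros cont wc gc fc)+
    have F': "continuous_on UNIV (\<lambda>p. F (prod.swap p))"
      by (rule cont(2)[OF F])
    have "L2_inner (?A f) g = (LINT p:unit_cell|lborel. F (prod.swap p) - G p)"
      by (simp add: L2_inner_def F_def G_def algebra_simps)
    also have "\<dots> = (LINT p:unit_cell|lborel. F (prod.swap p)) - (LINT p:unit_cell|lborel. G p)"
      by (rule set_integral_diff(2)[OF set_integrable_unit_cell[OF F'] set_integrable_unit_cell[OF G]])
    also have "\<dots> = (LINT p:unit_cell|lborel. F p) - (LINT p:unit_cell|lborel. G p)"
      by (simp only: set_integral_unit_cell_swap[OF F])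
    also have "\<dots> = (LINT p:unit_cell|lborel. F p - G p)"
      by (rule set_integral_diff(2)[symmetric, OF set_integrable_unit_cell[OF F] set_integrable_unit_cell[OF G]])
    also have "\<dots> = L2_inner f ?k"
      by (simp add: L2_inner_def F_def G_def scaleR_conv_of_real algebra_simps)
    finally show ?thesis .
  qed
  show "?k \<in> periodic_C0 \<and> (\<forall>f\<in>periodic_C0. L2_inner (?A f) g = L2_inner f ?k)"
    using k adj by blast
  fix k assume "k \<in> periodic_C0 \<and> (\<forall>f\<in>periodic_C0. L2_inner (?A f) g = L2_inner f k)"
  then have k': "k \<in> periodic_C0" "\<And>f. f \<in> periodic_C0 \<Longrightarrow> L2_inner f k = L2_inner f ?k"
    using adj by auto
  define d where "d p = k p - ?k p" for p
  have d: "d \<in> periodic_C0"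
    using k k'(1) unfolding d_def periodic_C0_def periodic_def
    by (auto intro!: continuous_on_diff)
  have L: "set_integrable lborel unit_cell (\<lambda>p. d p * cnj (u p))" if "u \<in> periodic_C0" for u
    using that d by (intro set_integrable_unit_cell continuous_intros) (auto simp: periodic_C0_def)
  have "L2_inner d d = (LINT p:unit_cell|lborel. d p * cnj (k p) - d p * cnj (?k p))"
    unfolding L2_inner_def by (subst (2) d_def) (simp add: algebra_simps)
  also have "\<dots> = L2_inner d k - L2_inner d ?k"
    unfolding L2_inner_def by (rule set_integral_diff(2)[OF L[OF k'(1)] L[OF k]])
  finally have "L2_inner d d = 0"
    using k'(2)[OF d] by simp
  then have "d = (\<lambda>_. 0)"
    by (rule L2_inner_self_eq_0[OF d])
  then show "k = ?k"
    by (simp add: d_def fun_eq_iff)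
qed

section \<open>The operators as diffusions on the product space\<close>

lemma sum_Basis_vec:
  fixes g :: "real^'n \<Rightarrow> 'b::comm_monoid_add"
  shows "sum g Basis = (\<Sum>i\<in>UNIV. g (axis i 1))"
proof -
  have range: "Basis = range (\<lambda>i::'n. axis i (1::real))"
    by (auto simp: Basis_vec_def)
  have "inj (\<lambda>i::'n. axis i (1::real))"
    by (auto simp: inj_on_def axis_eq_axis)
  then show ?thesis
    unfolding range by (simp add: sum.reindex)
qed

lemma sum_Basis_prod:
  fixes g :: "'a::euclidean_space \<times> 'c::euclidean_space \<Rightarrow> 'b::comm_monoid_add"
  shows "sum g Basis = (\<Sum>u\<in>Basis. g (u, 0)) + (\<Sum>v\<in>Basis. g (0, v))"
proof -
  have "inj_on (\<lambda>u. (u::'a, 0::'c)) Basis" "inj_on (Pair (0::'a)) (Basis :: 'c set)"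
    by (auto intro!: inj_onI)
  moreover have "(\<lambda>u. (u::'a, 0::'c)) ` Basis \<inter> Pair 0 ` Basis = {}"
    by auto
  ultimately show ?thesis
    unfolding Basis_prod_def by (simp add: sum.union_disjoint sum.reindex)
qed

lemma axis_Basis [simp]: "axis i (1::real) \<in> Basis"
  by (auto simp: Basis_vec_def)

lemma trace_hess: "trace (hess f x) = (\<Sum>i\<in>UNIV. pd (axis i 1) (pd (axis i 1) f) x)"
  by (simp add: trace_def hess_def)

lemma pairing_grad: "pairing v (grad f x) = (\<Sum>i\<in>UNIV. (v $ i) *\<^sub>R pd (axis i 1) f x)"
  by (simp add: pairing_def grad_def)

lemma pd_slice_fst:
  fixes f :: "'a::euclidean_space \<times> 'c::euclidean_space \<Rightarrow> 'b::real_normed_vector"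
  assumes "class_C1 f"
  shows "pd b (\<lambda>x. f (x, y)) = (\<lambda>x. pd (b, 0) f (x, y))"
proof (rule ext, rule pd_eqI)
  fix x :: 'a
  have "((\<lambda>x. (x, y)) has_derivative (\<lambda>v. (v, 0))) (at x)"
    by (intro has_derivative_Pair has_derivative_ident has_derivative_const)
  from has_derivative_compose[OF this class_C1_has_derivative[OF assms]]
  show "((\<lambda>x. f (x, y)) has_derivative (\<lambda>b. pd (b, 0) f (x, y))) (at x)" .
qed

lemma pd_slice_snd:
  fixes f :: "'a::euclidean_space \<times> 'c::euclidean_space \<Rightarrow> 'b::real_normed_vector"
  assumes "class_C1 f"
  shows "pd b (\<lambda>y. f (x, y)) = (\<lambda>y. pd (0, b) f (x, y))"
proof (rule ext, rule pd_eqI)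
  fix y :: 'c
  have "((\<lambda>y. (x, y)) has_derivative (\<lambda>v. (0, v))) (at y)"
    by (intro has_derivative_Pair has_derivative_ident has_derivative_const)
  from has_derivative_compose[OF this class_C1_has_derivative[OF assms]]
  show "((\<lambda>y. f (x, y)) has_derivative (\<lambda>b. pd (0, b) f (x, y))) (at y)" .
qed

text \<open>A basis vector of the product space has one zero component, so exactly one of the two
  inner products survives. The factor is that of \<open>H_op\<close>, and the signs are opposite
  because one variable carries the adjoint operator.\<close>

definition H_coeff :: "(real^'n \<Rightarrow> real) \<Rightarrow> (real^'n) \<times> (real^'n) \<Rightarrow> (real^'n) \<times> (real^'n) \<Rightarrow> real" where
  "H_coeff V b p = (1 / 2) * (grad V (fst p) \<bullet> fst b - grad V (snd p) \<bullet> snd b)"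

text \<open>The diffusivity \<open>\<epsilon> / 4\<close> is \<open>\<epsilon> / 2\<close> times the
  overall factor \<open>1 / 2\<close>; no mixed derivatives occur, so the two traces together form
  one Laplacian on the product space.\<close>

lemma H_op_eq_elliptic_op:
  fixes f :: "(real^'n) \<times> (real^'n) \<Rightarrow> 'b::real_normed_field"
  assumes f: "class_C2 f"
  shows "H_op \<epsilon> V c f p = - elliptic_op (\<epsilon> / 4) (H_coeff V) f p
    + ((1 / 2) * (- cstar V (fst p) + c (fst p) + c (snd p))) *\<^sub>R f p"
proof (cases p)
  case (Pair x y)
  have C1: "class_C1 f"
    by (rule class_C2_C1[OF f])
  have C1': "class_C1 (pd (axis i 1, 0) f)" "class_C1 (pd (0, axis i 1) f)" for i :: 'n
    by (rule class_C2_pd[OF f]; simp add: Basis_prod_def)+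
  have inner_axis_1: "v \<bullet> axis i 1 = v $ i" for v :: "real^'n" and i
    by (simp add: inner_axis)
  have "elliptic_op (\<epsilon> / 4) (H_coeff V) f (x, y) =
      (\<Sum>i\<in>UNIV. (\<epsilon> / 4) *\<^sub>R pd (axis i 1, 0) (pd (axis i 1, 0) f) (x, y)
        + ((1 / 2) * grad V x $ i) *\<^sub>R pd (axis i 1, 0) f (x, y))
    + (\<Sum>i\<in>UNIV. (\<epsilon> / 4) *\<^sub>R pd (0, axis i 1) (pd (0, axis i 1) f) (x, y)
        + (- (1 / 2) * grad V y $ i) *\<^sub>R pd (0, axis i 1) f (x, y))"
    unfolding elliptic_op_def sum_Basis_prod sum_Basis_vec
    by (simp add: H_coeff_def inner_axis_1)
  also have "\<dots> = (1 / 2) *\<^sub>R ((\<epsilon> / 2) *\<^sub>R trace (hess (\<lambda>x'. f (x', y)) x) + pairing (grad V x) (grad (\<lambda>x'. f (x', y)) x)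
      + (\<epsilon> / 2) *\<^sub>R trace (hess (\<lambda>y'. f (x, y')) y) - pairing (grad V y) (grad (\<lambda>y'. f (x, y')) y))"
    unfolding trace_hess pairing_grad pd_slice_fst[OF C1] pd_slice_snd[OF C1]
    unfolding pd_slice_fst[OF C1'(1)] pd_slice_snd[OF C1'(2)] sum.distrib
    by (simp add: scaleR_sum_right sum_negf algebra_simps)
  finally show ?thesis
    unfolding Pair H_op_def by (simp add: algebra_simps add_divide_distrib)
qed

lemma A_op_eq:
  "A_op \<epsilon> \<Psi> \<Phi> = (\<lambda>f p. exp (- (1 / \<epsilon>) *
    max (\<Psi> (snd p) + \<Phi> (fst p) - \<Psi> (fst p) - \<Phi> (snd p)) 0) *\<^sub>R (f (prod.swap p) - f p))"
  by (simp add: A_op_def fun_eq_iff)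

lemma periodic_C0_fst_snd:
  assumes "f \<in> periodic_C0"
  shows "(\<lambda>p :: 'a::euclidean_space \<times> 'a. f (fst p)) \<in> periodic_C0"
    and "(\<lambda>p :: 'a \<times> 'a. f (snd p)) \<in> periodic_C0"
proof -
  have "continuous_on UNIV (\<lambda>p :: 'a \<times> 'a. f (fst p))" "continuous_on UNIV (\<lambda>p :: 'a \<times> 'a. f (snd p))"
    using assms by (auto simp: periodic_C0_def intro!: continuous_on_compose2[of UNIV f] continuous_intros)
  then show "(\<lambda>p :: 'a \<times> 'a. f (fst p)) \<in> periodic_C0" "(\<lambda>p :: 'a \<times> 'a. f (snd p)) \<in> periodic_C0"
    using assms by (auto simp: periodic_C0_def periodic_def Basis_prod_def ball_Un)
qed

lemma periodic_C2_fst_snd: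
  assumes "f \<in> periodic_C2"
  shows "(\<lambda>p :: 'a::euclidean_space \<times> 'a. f (fst p)) \<in> periodic_C2"
    and "(\<lambda>p :: 'a \<times> 'a. f (snd p)) \<in> periodic_C2"
  using assms class_C2_compose_linear[OF bounded_linear_fst, of f]
    class_C2_compose_linear[OF bounded_linear_snd, of f]
  by (auto simp: periodic_C2_def periodic_def Basis_prod_def ball_Un)

text \<open>Serves two purposes: \<open>of_real\<close> carries the complex eigenvalue equations
  back to real ones, and multiplication by a constant handles the slices of a product
  function.\<close>

lemma
  fixes g :: "real^'n \<Rightarrow> real"
  assumes "class_C2 g" "bounded_linear (L :: real \<Rightarrow> 'b::real_normed_field)"
  shows pairing_grad_bounded_linear: "pairing v (grad (\<lambda>x. L (g x)) x) = L (pairing v (grad g x))"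
    and trace_hess_bounded_linear: "trace (hess (\<lambda>x. L (g x)) x) = L (trace (hess g x))"
proof -
  interpret L: bounded_linear L by fact
  note pd_L = pd_bounded_linear[OF assms(2)]
  show "pairing v (grad (\<lambda>x. L (g x)) x) = L (pairing v (grad g x))"
    unfolding pairing_grad pd_L[OF class_C2_C1[OF assms(1)]] by (simp only: L.sum L.scaleR)
  show "trace (hess (\<lambda>x. L (g x)) x) = L (trace (hess g x))"
    unfolding trace_hess pd_L[OF class_C2_C1[OF assms(1)]] pd_L[OF class_C2_pd[OF assms(1) axis_Basis]]
    by (simp only: L.sum)
qed

lemma dominant_pair_periodic_C2:
  assumes "dominant_pair M g \<mu>"
  shows "g \<in> periodic_C2"
proof -
  have "(\<lambda>x. complex_of_real (g x)) \<in> periodic_C2"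
    using assms by (simp add: dominant_pair_def eigenpair_def)
  from periodic_C2_bounded_linear[OF bounded_linear_Re this] show ?thesis
    by simp
qed

lemma L_op_of_real:
  assumes "class_C2 g"
  shows "L_op \<epsilon> V (\<lambda>x. complex_of_real (g x)) x = of_real (L_op \<epsilon> V g x)"
    and "Lstar_op \<epsilon> V (\<lambda>x. complex_of_real (g x)) x = of_real (Lstar_op \<epsilon> V g x)"
  by (simp_all add: L_op_def Lstar_op_def scaleR_conv_of_real
      pairing_grad_bounded_linear[OF assms bounded_linear_of_real]
      trace_hess_bounded_linear[OF assms bounded_linear_of_real])

text \<open>\<open>H_op\<close> is half the sum of \<open>- Lstar_op + c\<close> in the first
  variable and \<open>- L_op + c\<close> in the second; on a product each contributes the same
  eigenvalue \<open>lam\<close>.\<close>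

lemma H_op_product:
  fixes \<psi> \<phi> :: "real^'n \<Rightarrow> real"
  assumes "class_C2 \<psi>" "class_C2 \<phi>"
    and \<psi>: "- Lstar_op \<epsilon> V \<psi> x + c x * \<psi> x = lam * \<psi> x"
    and \<phi>: "- L_op \<epsilon> V \<phi> y + c y * \<phi> y = lam * \<phi> y"
  shows "H_op \<epsilon> V c (\<lambda>p. \<psi> (fst p) * \<phi> (snd p)) (x, y) = lam * (\<psi> x * \<phi> y)"
proof -
  note slices = pairing_grad_bounded_linear[OF assms(1) bounded_linear_mult_left]
    trace_hess_bounded_linear[OF assms(1) bounded_linear_mult_left]
    pairing_grad_bounded_linear[OF assms(2) bounded_linear_mult_right]
    trace_hess_bounded_linear[OF assms(2) bounded_linear_mult_right]
  have "H_op \<epsilon> V c (\<lambda>p. \<psi> (fst p) * \<phi> (snd p)) (x, y) =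
      (1 / 2) * ((- Lstar_op \<epsilon> V \<psi> x + c x * \<psi> x) * \<phi> y + \<psi> x * (- L_op \<epsilon> V \<phi> y + c y * \<phi> y))"
    unfolding H_op_def prod.case fst_conv snd_conv slices L_op_def Lstar_op_def
    by (simp add: algebra_simps)
  also have "\<dots> = lam * (\<psi> x * \<phi> y)"
    unfolding \<psi> \<phi> by simp
  finally show ?thesis .
qed

text \<open>Both sides equal the exponential of \<open>- (1 / \<epsilon>) * max r s\<close>, which
  is symmetric in \<open>r\<close> and \<open>s\<close>.\<close>

lemma metropolis_detailed_balance:
  fixes r s \<epsilon> :: real
  shows "exp (- (1 / \<epsilon>) * max (s - r) 0) * exp (- (1 / \<epsilon>) * r) =
    exp (- (1 / \<epsilon>) * max (r - s) 0) * exp (- (1 / \<epsilon>) * s)"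
proof -
  have "max (s - r) 0 + r = max (r - s) 0 + s"
    by simp
  then show ?thesis
    unfolding exp_add[symmetric] distrib_left[symmetric] by simp
qed

theorem lemma2p5:
  fixes V c \<psi> \<phi> \<Psi> \<Phi> :: "real^'n \<Rightarrow> real" and \<epsilon> \<alpha> lam :: real
    and h :: "(real^'n) \<times> (real^'n) \<Rightarrow> real"
  assumes eps: "\<epsilon> > 0"
    and alpha: "0 < \<alpha>" "\<alpha> \<le> 1"
    and V_periodic: "periodic V"
    and c_periodic: "periodic c"
    and V_differentiable: "\<And>x. V differentiable (at x)"
    and DV_C1_hoelder: "\<And>i. class_C1_hoelder \<alpha> (\<lambda>x. grad V x $ i)"
    and c_hoelder: "hoelder \<alpha> c"
    and c_nonneg: "\<And>x. c x \<ge> 0"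
    and c_cstar: "\<And>x. c x - cstar V x \<ge> 0"
    and psi: "dominant_pair (\<lambda>f x. - Lstar_op \<epsilon> V f x + c x *\<^sub>R f x) \<psi> lam"
    and phi: "dominant_pair (\<lambda>f x. - L_op \<epsilon> V f x + c x *\<^sub>R f x) \<phi> lam"
    and Psi: "\<And>x. \<psi> x = exp (- (1 / \<epsilon>) * \<Psi> x)"
    and Phi: "\<And>x. \<phi> x = exp (- (1 / \<epsilon>) * \<Phi> x)"
    and h: "\<And>x y. h (x, y) = \<psi> x * \<phi> y"
  shows "eigenpair (H_op \<epsilon> V c) h lam \<and>
    dominant_pair (\<lambda>f p. H_op \<epsilon> V c f p - torus_adjoint (A_op \<epsilon> \<Psi> \<Phi>) f p) h lam"
proof -
  have \<psi>_C2: "\<psi> \<in> periodic_C2" and \<phi>_C2: "\<phi> \<in> periodic_C2"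
    using dominant_pair_periodic_C2 psi phi by blast+
  then have C2: "class_C2 \<psi>" "class_C2 \<phi>"
    by (auto simp: periodic_C2_def)
  have \<psi>_eq: "- Lstar_op \<epsilon> V \<psi> x + c x * \<psi> x = lam * \<psi> x" for x
  proof -
    have "complex_of_real (- Lstar_op \<epsilon> V \<psi> x + c x * \<psi> x) = of_real (lam * \<psi> x)"
      using psi by (simp add: dominant_pair_def eigenpair_def L_op_of_real C2 scaleR_conv_of_real)
    then show ?thesis
      by (simp only: of_real_eq_iff)
  qed
  have \<phi>_eq: "- L_op \<epsilon> V \<phi> x + c x * \<phi> x = lam * \<phi> x" for x
  proof -
    have "complex_of_real (- L_op \<epsilon> V \<phi> x + c x * \<phi> x) = of_real (lam * \<phi> x)"
      using phi by (simp add: dominant_pair_def eigenpair_def L_op_of_real C2 scaleR_conv_of_real)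
    then show ?thesis
      by (simp only: of_real_eq_iff)
  qed
  have h_eq: "h = (\<lambda>p. \<psi> (fst p) * \<phi> (snd p))"
    using h by (auto simp: fun_eq_iff)
  have h_C2: "h \<in> periodic_C2"
    unfolding h_eq by (rule periodic_C2_bilinear[OF bounded_bilinear_mult
          periodic_C2_fst_snd(1)[OF \<psi>_C2] periodic_C2_fst_snd(2)[OF \<phi>_C2]])
  have h_pos: "h p > 0" for p
    by (simp add: h_eq Psi Phi)
  have H_h: "H_op \<epsilon> V c h p = lam * h p" for p
    unfolding h_eq using H_op_product[OF C2 \<psi>_eq[of "fst p"] \<phi>_eq[of "snd p"]] by simp
  have "eigenpair (H_op \<epsilon> V c) h lam"
    using h_C2 H_h h_pos[of 0] by (auto simp: eigenpair_def)
  define w where "w p = exp (- (1 / \<epsilon>) *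
    max (\<Psi> (snd p) + \<Phi> (fst p) - \<Psi> (fst p) - \<Phi> (snd p)) 0)" for p
  have log_C0: "(\<lambda>x. - \<epsilon> * ln (g x)) \<in> periodic_C0" if "g \<in> periodic_C2" "\<And>x. g x > 0" for g :: "real^'n \<Rightarrow> real"
    using periodic_C2_C0[OF that(1)] that(2)
    by (auto simp: periodic_C0_def periodic_def less_imp_neq[symmetric] intro!: continuous_intros)
  \<comment> \<open>Solving for the exponents transfers continuity and periodicity from the
    eigenfunctions to \<open>\<Psi>\<close> and \<open>\<Phi>\<close>, and thereby to the weight
    \<open>w\<close>.\<close>
  have "\<Psi> = (\<lambda>x. - \<epsilon> * ln (\<psi> x))" "\<Phi> = (\<lambda>x. - \<epsilon> * ln (\<phi> x))"
    using eps by (simp_all add: Psi Phi fun_eq_iff)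
  then have "\<Psi> \<in> periodic_C0" "\<Phi> \<in> periodic_C0"
    using log_C0[OF \<psi>_C2] log_C0[OF \<phi>_C2] Psi Phi by simp_all
  note Psi_Phi = periodic_C0_fst_snd[OF \<open>\<Psi> \<in> periodic_C0\<close>] periodic_C0_fst_snd[OF \<open>\<Phi> \<in> periodic_C0\<close>]
  have w_C0: "w \<in> periodic_C0"
    using Psi_Phi eps unfolding w_def periodic_C0_def periodic_def
    by (auto intro!: continuous_intros)
  have grad_C0: "(\<lambda>x. grad V x $ i) \<in> periodic_C0" for i
  proof -
    have "class_C1 (\<lambda>x. grad V x $ i)"
      using DV_C1_hoelder by (simp add: class_C1_hoelder_def)
    then show ?thesis
      using class_C1_continuous periodic_pd[OF V_periodic V_differentiable]
      by (auto simp: periodic_C0_def grad_def)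
  qed
  have coeff_C0: "H_coeff V b \<in> periodic_C0" for b
    using periodic_C0_fst_snd[OF grad_C0]
    unfolding H_coeff_def inner_vec_def periodic_C0_def periodic_def
    by (auto intro!: continuous_on_divide continuous_on_mult continuous_on_diff continuous_on_sum
        continuous_on_const)
  interpret jump_diffusion "\<epsilon> / 4" 1 lam "H_coeff V"
    "\<lambda>p. (1 / 2) * (- cstar V (fst p) + c (fst p) + c (snd p))" w h prod.swap
  proof
    show "w (prod.swap p) * h (prod.swap p) = w p * h p" for p
    proof (cases p)
      case (Pair x y)
      then show ?thesis
        \<comment> \<open>The two arguments are the exponents of \<open>h\<close> at
          \<open>(x, y)\<close> and at the swapped point.\<close>
        using metropolis_detailed_balance[of \<epsilon> "\<Psi> x + \<Phi> y" "\<Psi> y + \<Phi> x"]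
        by (simp add: w_def h_eq Psi Phi exp_add[symmetric] algebra_simps)
    qed
    show "- elliptic_op (\<epsilon> / 4) (H_coeff V) h p + (1 / 2) * (- cstar V (fst p) + c (fst p) + c (snd p)) * h p = lam * h p" for p
      using H_h[of p] H_op_eq_elliptic_op[of h \<epsilon> V c p] h_C2 by (simp add: periodic_C2_def)
    show "w p \<le> 1" for p
      using eps by (simp add: w_def)
  qed (use eps coeff_C0 h_C2 h_pos in \<open>auto simp: w_def\<close>)
  have "dominant_pair (\<lambda>f p. H_op \<epsilon> V c f p - torus_adjoint (A_op \<epsilon> \<Psi> \<Phi>) f p) h lam"
  proof (rule dominant_pair_h)
    fix f :: "(real^'n) \<times> (real^'n) \<Rightarrow> complex" and p
    assume f: "f \<in> periodic_C2"
    have adjoint: "torus_adjoint (A_op \<epsilon> \<Psi> \<Phi>) f p = w (prod.swap p) *\<^sub>R f (prod.swap p) - w p *\<^sub>R f p"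
      unfolding A_op_eq w_def[symmetric] torus_adjoint_swap[OF w_C0 periodic_C2_C0[OF f]] ..
    have "class_C2 f"
      using f by (simp add: periodic_C2_def)
    then show "H_op \<epsilon> V c f p - torus_adjoint (A_op \<epsilon> \<Psi> \<Phi>) f p = full_op f p"
      unfolding adjoint full_op_def by (simp only: H_op_eq_elliptic_op) simp
  qed
  with \<open>eigenpair (H_op \<epsilon> V c) h lam\<close> show ?thesis
    by blast
qed

end
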